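(* Let $q$ be an integer with $q\geq2$ and let $p\in\{-1,1\}$. Let $\tau$ be a root of $X^2-pX+q$, let $w\geq2$ be an integer and let $\mathcal{D}$ be the minimal norm representative digit set modulo $\tau^w$. Then there exists an effectively computable bound $w_q$ such that for all $w\geq w_q$ the width-$w$ non-adjacent form expansion is not optimal with respect to $\tau$ and $\mathcal{D}$. In particular, one may choose $w_q=8.68\cdot 10^{15}\log q\log\log q$ if $q\geq13$, and $w_q=1.973\cdot10^{16}$ if $q\in\{2,3,\dots,12\}$.
   Context: $\mathbb{Z}[\tau]=\{a+b\tau: a,b\in\mathbb{Z}\}$. The minimal norm representative digit set modulo $\tau^w$ is the set $\mathcal{D}\subseteq\mathbb{Z}[\tau]$ consisting of $0$ together with, for each residue class of $\mathbb{Z}[\tau]$ modulo $\tau^w$ whose elements are not divisible by $\tau$, a representative of minimal absolute value (equivalently, a representative lying in $\tau^w V$, where $V=\{z\in\mathbb{C}: |z|\le|z-y| \text{ for all } y\in\mathbb{Z}[\tau]\}$ is the Voronoi cell of $0$). A digit expansion of $z$ is a finite sum $z=\sum_{\ell=0}^{L-1}\sigma_\ell\tau^\ell$ with $\sigma_\ell\in\mathcal{D}$. It is a width-$w$ non-adjacent form ($w$-NAF) if every block $\sigma_\ell\sigma_{\ell+1}\cdots\sigma_{\ell+w-1}$ ($0\le\ell\le L-w$) contains at most one nonzero digit. The weight of an expansion is its number of nonzero digits; an expansion of $z$ is optimal if no expansion of $z$ with digits in $\mathcal{D}$ has smaller weight. The $w$-NAF expansion is called optimal (with respect to $\tau$ and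 $\mathcal{D}$) if the $w$-NAF of every element of $\mathbb{Z}[\tau]$ is optimal. (Every element of $\mathbb{Z}[\tau]$ has a unique $w$-NAF expansion.) *)

theory Defs
  imports Complex_Main
begin

definition Ztau :: "complex \<Rightarrow> complex set" where
  "Ztau \<tau> = {of_int a + of_int b * \<tau> | a b :: int. True}"

definition Ztau_dvd :: "complex \<Rightarrow> complex \<Rightarrow> complex \<Rightarrow> bool" where
  "Ztau_dvd \<tau> x z \<longleftrightarrow> (\<exists>y\<in>Ztau \<tau>. z = x * y)"

text \<open>
  Residue classes may contain several elements of minimal absolute value, so the minimal norm
  representative digit set is a predicate on sets, covering every possible choice of
  representatives.
\<close>

definition min_norm_digit_set :: "complex \<Rightarrow> nat \<Rightarrow> complex set \<Rightarrow> bool" where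
  "min_norm_digit_set \<tau> w D \<longleftrightarrow>
     D \<subseteq> Ztau \<tau> \<and> 0 \<in> D \<and>
     (\<forall>d\<in>D - {0}. \<not> Ztau_dvd \<tau> \<tau> d) \<and>
     (\<forall>z\<in>Ztau \<tau>. \<not> Ztau_dvd \<tau> \<tau> z \<longrightarrow> (\<exists>!d. d \<in> D \<and> Ztau_dvd \<tau> (\<tau> ^ w) (z - d))) \<and>
     (\<forall>d\<in>D - {0}. \<forall>z\<in>Ztau \<tau>. Ztau_dvd \<tau> (\<tau> ^ w) (z - d) \<longrightarrow> cmod d \<le> cmod z)"

text \<open>
  Digit expansions, least significant digit first, are padded with zero digits to infinite
  sequences.  Expansions differing only in leading zeros are thereby identified, and the block
  condition below also constrains expansions with fewer than \<open>w\<close> digits.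
\<close>

definition digit_expansion ::
    "complex \<Rightarrow> complex set \<Rightarrow> complex \<Rightarrow> (nat \<Rightarrow> complex) \<Rightarrow> bool" where
  "digit_expansion \<tau> D z \<sigma> \<longleftrightarrow>
     (\<forall>l. \<sigma> l \<in> D) \<and> (\<exists>L. (\<forall>l\<ge>L. \<sigma> l = 0) \<and> z = (\<Sum>l<L. \<sigma> l * \<tau> ^ l))"

definition weight :: "(nat \<Rightarrow> complex) \<Rightarrow> nat" where
  "weight \<sigma> = card {l. \<sigma> l \<noteq> 0}"

definition wNAF ::
    "complex \<Rightarrow> nat \<Rightarrow> complex set \<Rightarrow> complex \<Rightarrow> (nat \<Rightarrow> complex) \<Rightarrow> bool" where
  "wNAF \<tau> w D z \<sigma> \<longleftrightarrow>
     digit_expansion \<tau> D z \<sigma> \<and> (\<forall>l. card {j \<in> {l..<l + w}. \<sigma> j \<noteq> 0} \<le> 1)"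

definition optimal_expansion ::
    "complex \<Rightarrow> complex set \<Rightarrow> complex \<Rightarrow> (nat \<Rightarrow> complex) \<Rightarrow> bool" where
  "optimal_expansion \<tau> D z \<sigma> \<longleftrightarrow>
     digit_expansion \<tau> D z \<sigma> \<and> (\<forall>\<rho>. digit_expansion \<tau> D z \<rho> \<longrightarrow> weight \<sigma> \<le> weight \<rho>)"

definition wNAF_optimal :: "complex \<Rightarrow> nat \<Rightarrow> complex set \<Rightarrow> bool" where
  "wNAF_optimal \<tau> w D \<longleftrightarrow>
     (\<forall>z\<in>Ztau \<tau>. \<forall>\<sigma>. wNAF \<tau> w D z \<sigma> \<longrightarrow> optimal_expansion \<tau> D z \<sigma>)"

text \<open>
  Total recursive functions of arity \<open>n\<close>, as functions on argument lists of length \<open>n\<close>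
  (values on other lists are irrelevant).  Minimisation is restricted to regular functions,
  which by Kleene's normal form theorem still yields all total computable functions.
\<close>

inductive total_recursive :: "nat \<Rightarrow> (nat list \<Rightarrow> nat) \<Rightarrow> bool" where
  zero: "total_recursive n (\<lambda>xs. 0)"
| succ: "total_recursive 1 (\<lambda>xs. Suc (hd xs))"
| proj: "i < n \<Longrightarrow> total_recursive n (\<lambda>xs. xs ! i)"
| comp: "total_recursive (length gs) f \<Longrightarrow> (\<forall>g\<in>set gs. total_recursive n g) \<Longrightarrow>
    total_recursive n (\<lambda>xs. f (map (\<lambda>g. g xs) gs))"
| prim_rec: "total_recursive n f \<Longrightarrow> total_recursive (Suc (Suc n)) g \<Longrightarrow>
    total_recursive (Suc n)
      (\<lambda>xs. rec_nat (f (tl xs)) (\<lambda>k r. g (k # r # tl xs)) (hd xs))"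
| minimisation: "total_recursive (Suc n) f \<Longrightarrow> (\<forall>xs. length xs = n \<longrightarrow> (\<exists>y. f (y # xs) = 0)) \<Longrightarrow>
    total_recursive n (\<lambda>xs. LEAST y. f (y # xs) = 0)"

definition effectively_computable :: "(nat \<Rightarrow> nat) \<Rightarrow> bool" where
  "effectively_computable f \<longleftrightarrow> (\<exists>g. total_recursive 1 g \<and> (\<forall>x. g [x] = f x))"

definition nonoptimality_bound :: "nat \<Rightarrow> real \<Rightarrow> bool" where
  "nonoptimality_bound q B \<longleftrightarrow>
     (\<forall>p\<in>{-1, 1 :: int}. \<forall>\<tau> :: complex. \<tau>\<^sup>2 - of_int p * \<tau> + of_nat q = 0 \<longrightarrow>
        (\<forall>w\<ge>2. real w \<ge> B \<longrightarrow>
           (\<forall>D. min_norm_digit_set \<tau> w D \<longrightarrow> \<not> wNAF_optimal \<tau> w D)))"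

end

theory Submission
  imports Defs
begin

text \<open>
  Write \<open>T = \<tau> ^ w\<close> and \<open>V\<close> for the Voronoi cell of \<open>0\<close>.  Dividing by \<open>\<tau>\<close> turns the edge of \<open>V\<close> on the
  bisector of \<open>0\<close> and \<open>\<tau>\<close> into a segment on the bisector of \<open>0\<close> and \<open>1\<close>, so \<open>V / \<tau>\<close> touches the boundary
  of \<open>V\<close> along a segment around \<open>1 / 2\<close>.  A digit \<open>B\<close> with \<open>B / \<tau>\<close> just inside the corresponding edge
  of \<open>T V\<close> can therefore be pushed across it by a carry: for a suitable digit \<open>A\<close> we get
  \<open>A + B \<tau> ^ (w - 1) = C + T E\<close> with a digit \<open>C\<close> and \<open>E = (B + u) / \<tau>\<close>, where \<open>E\<close> is not divisible by
  \<open>\<tau>\<close> and lies outside \<open>T V\<close>.  Then \<open>E\<close> has weight at least two, so the non-adjacent form has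
  weight at least three although the left-hand side has weight two.

  Such \<open>E\<close> are sought in the form \<open>(T + m) / 2\<close> with \<open>m\<close> small.  What is needed is that the
  projection of \<open>m / 2\<close> to the direction of \<open>T\<close> is nonzero and shorter than that of some admissible
  carry \<open>u / \<tau>\<close>.  In all but one class of \<open>T\<close> modulo \<open>2\<close> a bounded \<open>m\<close> works.  In the remaining class
  \<open>3\<close> divides \<open>w - 1\<close>, and \<open>m = 2 cnj \<tau> + a \<tau>\<close> is used with an odd \<open>a\<close> that is small compared
  to \<open>T\<close> because the trace of \<open>\<tau> ^ (w - 1)\<close> cannot be small.  This elementary bound replaces
  the use of linear forms in logarithms and holds for every \<open>w \<ge> 100\<close>.
\<close>

subsection \<open>Digit expansions\<close>

text \<open>Two nonzero positions less than \<open>w\<close> apart share the window that starts at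
  the lower one. The gap form is easier to carry through the shift in
  \<open>wNAF_prepend\<close>.\<close>

lemma wNAF_iff:
  "wNAF \<tau> w D z \<sigma> \<longleftrightarrow>
     digit_expansion \<tau> D z \<sigma> \<and> (\<forall>i j. i < j \<longrightarrow> \<sigma> i \<noteq> 0 \<longrightarrow> \<sigma> j \<noteq> 0 \<longrightarrow> i + w \<le> j)"
proof -
  have "(\<forall>l. card {j \<in> {l..<l + w}. \<sigma> j \<noteq> 0} \<le> 1) \<longleftrightarrow>
      (\<forall>i j. i < j \<longrightarrow> \<sigma> i \<noteq> 0 \<longrightarrow> \<sigma> j \<noteq> 0 \<longrightarrow> i + w \<le> j)" (is "?L \<longleftrightarrow> ?R")
  proof
    assume L: ?L
    show ?R
    proof (intro allI impI, rule ccontr)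
      fix i j assume ij: "i < j" "\<sigma> i \<noteq> 0" "\<sigma> j \<noteq> 0" "\<not> i + w \<le> j"
      let ?S = "{k \<in> {i..<i + w}. \<sigma> k \<noteq> 0}"
      have "{i, j} \<subseteq> ?S" using ij by simp
      then have "card {i, j} \<le> card ?S" by (rule card_mono[rotated]) simp
      with ij(1) spec[OF L, of i] show False by simp
    qed
  next
    assume R: ?R
    show ?L
    proof
      fix l
      have "\<forall>a\<in>{j \<in> {l..<l + w}. \<sigma> j \<noteq> 0}. \<forall>b\<in>{j \<in> {l..<l + w}. \<sigma> j \<noteq> 0}. a = b"
      proof (intro ballI)
        fix a b
        assume a: "a \<in> {j \<in> {l..<l + w}. \<sigma> j \<noteq> 0}" and b: "b \<in> {j \<in> {l..<l + w}. \<sigma> j \<noteq> 0}"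
        from a b R have "\<not> a < b" "\<not> b < a" by fastforce+
        then show "a = b" by simp
      qed
      then have "card {j \<in> {l..<l + w}. \<sigma> j \<noteq> 0} \<le> Suc 0"
        by (subst card_le_Suc0_iff_eq) auto
      then show "card {j \<in> {l..<l + w}. \<sigma> j \<noteq> 0} \<le> 1" by simp
    qed
  qed
  then show ?thesis unfolding wNAF_def by blast
qed

lemma digit_expansion_support:
  assumes "digit_expansion \<tau> D z \<sigma>"
  shows "finite {l. \<sigma> l \<noteq> 0}" and "z = (\<Sum>l | \<sigma> l \<noteq> 0. \<sigma> l * \<tau> ^ l)"
proof -
  from assms obtain L where L: "\<And>l. l \<ge> L \<Longrightarrow> \<sigma> l = 0" "z = (\<Sum>l<L. \<sigma> l * \<tau> ^ l)"
    by (auto simp: digit_expansion_def)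
  have sub: "{l. \<sigma> l \<noteq> 0} \<subseteq> {..<L}" 
    using L(1) by (metis (mono_tags) lessThan_iff mem_Collect_eq not_le_imp_less subsetI)
  then show "finite {l. \<sigma> l \<noteq> 0}" by (rule finite_subset) simp
  show "z = (\<Sum>l | \<sigma> l \<noteq> 0. \<sigma> l * \<tau> ^ l)"
    unfolding L(2) by (rule sum.mono_neutral_right) (use sub in auto)
qed

text \<open>Applied with positive \<open>n\<close> only. The choices \<open>n = 1\<close> and
  \<open>n = w\<close> are the two steps of the recursion for non-adjacent forms;
  \<open>n = w - 1\<close> builds the competing expansion of weight two.\<close>

definition prepend :: "complex \<Rightarrow> nat \<Rightarrow> (nat \<Rightarrow> complex) \<Rightarrow> nat \<Rightarrow> complex" where
  "prepend d n \<sigma> = (\<lambda>l. if l = 0 then d else if l < n then 0 else \<sigma> (l - n))"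

lemma digit_expansion_prepend:
  assumes "digit_expansion \<tau> D z \<sigma>" "d \<in> D" "0 \<in> D" "0 < n"
  shows "digit_expansion \<tau> D (d + \<tau> ^ n * z) (prepend d n \<sigma>)"
proof -
  from assms(1) obtain L where L: "\<And>l. \<sigma> l \<in> D" "\<And>l. l \<ge> L \<Longrightarrow> \<sigma> l = 0" "z = (\<Sum>l<L. \<sigma> l * \<tau> ^ l)"
    by (auto simp: digit_expansion_def)
  have base: "(\<Sum>l<n. prepend d n \<sigma> l * \<tau> ^ l) = d"
  proof -
    have "(\<Sum>l<n. prepend d n \<sigma> l * \<tau> ^ l) = (\<Sum>l<n. if l = 0 then d else 0)"
      by (rule sum.cong) (auto simp: prepend_def)
    with assms(4) show ?thesis by simp
  qed
  have "(\<Sum>l<n + M. prepend d n \<sigma> l * \<tau> ^ l) = d + \<tau> ^ n * (\<Sum>l<M. \<sigma> l * \<tau> ^ l)" for M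
  proof (induction M)
    case 0
    show ?case using base by simp
  next
    case (Suc M)
    have "prepend d n \<sigma> (n + M) = \<sigma> M" using assms(4) by (simp add: prepend_def)
    with Suc show ?case by (simp add: algebra_simps power_add)
  qed
  from this[of L] have "d + \<tau> ^ n * z = (\<Sum>l<n + L. prepend d n \<sigma> l * \<tau> ^ l)"
    using L(3) by simp
  moreover have "prepend d n \<sigma> l \<in> D" for l using L(1) assms by (simp add: prepend_def)
  moreover have "prepend d n \<sigma> l = 0" if "l \<ge> n + L" for l
    using that assms(4) L(2) by (simp add: prepend_def)
  ultimately show ?thesis unfolding digit_expansion_def by blast
qed

lemma wNAF_prepend:
  assumes "wNAF \<tau> w D z \<sigma>" "d \<in> D" "0 \<in> D" "0 < n" "d = 0 \<or> w \<le> n"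
  shows "wNAF \<tau> w D (d + \<tau> ^ n * z) (prepend d n \<sigma>)"
proof -
  have gap: "i + w \<le> j" if "i < j" "\<sigma> i \<noteq> 0" "\<sigma> j \<noteq> 0" for i j
    using assms(1) that by (simp add: wNAF_iff)
  have "i + w \<le> j" if ij: "i < j" "prepend d n \<sigma> i \<noteq> 0" "prepend d n \<sigma> j \<noteq> 0" for i j
  proof -
    have j: "n \<le> j" "\<sigma> (j - n) \<noteq> 0"
      using ij(1,3) by (auto simp: prepend_def split: if_splits)
    show ?thesis
    proof (cases "i = 0")
      case True
      then have "d \<noteq> 0" using ij(2) by (simp add: prepend_def)
      with assms(5) j True show ?thesis by simp
    next
      case False
      then have i: "n \<le> i" "\<sigma> (i - n) \<noteq> 0"
        using ij(2) by (auto simp: prepend_def split: if_splits)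
      with gap[of "i - n" "j - n"] ij(1) j show ?thesis by linarith
    qed
  qed
  moreover have "digit_expansion \<tau> D (d + \<tau> ^ n * z) (prepend d n \<sigma>)"
    using assms by (intro digit_expansion_prepend) (auto simp: wNAF_def)
  ultimately show ?thesis by (simp add: wNAF_iff)
qed

lemma weight_prepend:
  assumes "digit_expansion \<tau> D z \<sigma>" "d \<noteq> 0" "0 < n"
  shows "weight (prepend d n \<sigma>) = Suc (weight \<sigma>)"
proof -
  have "{l. prepend d n \<sigma> l \<noteq> 0} = insert 0 ((\<lambda>l. l + n) ` {l. \<sigma> l \<noteq> 0})"
  proof (intro set_eqI iffI)
    fix l assume l: "l \<in> {l. prepend d n \<sigma> l \<noteq> 0}"
    show "l \<in> insert 0 ((\<lambda>l. l + n) ` {l. \<sigma> l \<noteq> 0})"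
    proof (cases "l = 0")
      case False
      with l have "n \<le> l" "\<sigma> (l - n) \<noteq> 0" by (auto simp: prepend_def split: if_splits)
      then have "l = (l - n) + n" "l - n \<in> {l. \<sigma> l \<noteq> 0}" by auto
      then show ?thesis by blast
    qed simp
  qed (use assms(2,3) in \<open>auto simp: prepend_def\<close>)
  moreover have "card ((\<lambda>l. l + n) ` {l. \<sigma> l \<noteq> 0}) = card {l. \<sigma> l \<noteq> 0}"
    by (rule card_image) (simp add: inj_on_def)
  moreover have "finite ((\<lambda>l. l + n) ` {l. \<sigma> l \<noteq> 0})"
    using digit_expansion_support(1)[OF assms(1)] by simp
  moreover have "0 \<notin> (\<lambda>l. l + n) ` {l. \<sigma> l \<noteq> 0}" using assms(3) by auto
  ultimately show ?thesis by (simp add: weight_def)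
qed

lemma wNAF_zero: "0 \<in> D \<Longrightarrow> wNAF \<tau> w D 0 (\<lambda>l. 0)"
  by (auto simp: wNAF_iff digit_expansion_def)

subsection \<open>Arithmetic in the ring\<close>

locale trace_one_base =
  fixes q :: nat and p :: int and \<tau> :: complex
  assumes q_ge_2: "2 \<le> q"
    and p_unit: "p = -1 \<or> p = 1"
    and tau_eq: "\<tau>\<^sup>2 - of_int p * \<tau> + of_nat q = 0"
begin

lemma p_sq_real [simp]: "real_of_int p * real_of_int p = 1" "(real_of_int p)\<^sup>2 = 1"
  using p_unit by auto

lemma odd_p: "odd p"
  using p_unit by auto

lemma real_q_ge_2: "2 \<le> real q"
  using q_ge_2 by simp

text \<open>The discriminant \<open>1 - 4 * q\<close> is negative, so the root is not real. No sign
  of \<open>Im \<tau>\<close> is fixed, which covers both roots at once.\<close>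

lemma Re_Im_tau: "Re \<tau> = of_int p / 2 \<and> (Im \<tau>)\<^sup>2 = real q - 1 / 4"
proof -
  have re: "(Re \<tau>)\<^sup>2 - (Im \<tau>)\<^sup>2 - p * Re \<tau> + q = 0"
    using arg_cong[OF tau_eq, of Re] by (simp add: power2_eq_square)
  have im: "2 * Re \<tau> * Im \<tau> - p * Im \<tau> = 0"
    using arg_cong[OF tau_eq, of Im] by (simp add: power2_eq_square)
  have "Im \<tau> \<noteq> 0"
  proof
    assume "Im \<tau> = 0"
    with re have "(Re \<tau> - p / 2)\<^sup>2 + (real q - 1 / 4) = 0"
      by (simp add: power2_diff field_simps)
    moreover have "(Re \<tau> - p / 2)\<^sup>2 \<ge> 0" by simp
    ultimately show False using real_q_ge_2 by linarith
  qed
  moreover have "Im \<tau> * (2 * Re \<tau> - p) = 0"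
    using im by (simp add: algebra_simps)
  ultimately have R: "Re \<tau> = p / 2" by simp
  have "(Re \<tau>)\<^sup>2 = 1 / 4" "p * Re \<tau> = 1 / 2"
    unfolding R by (simp_all add: power_divide)
  with re have "(Im \<tau>)\<^sup>2 = real q - 1 / 4" by linarith
  with R show ?thesis by simp
qed

lemmas Re_tau = Re_Im_tau[THEN conjunct1] and Im_tau_sq = Re_Im_tau[THEN conjunct2]

lemma Im_tau_nz: "Im \<tau> \<noteq> 0"
  using Im_tau_sq real_q_ge_2 by auto

lemma cnj_tau: "cnj \<tau> = of_int p - \<tau>"
  by (simp add: complex_eq_iff Re_tau)

lemma tau_cnj: "\<tau> * cnj \<tau> = of_nat q"
  using tau_eq by (simp add: cnj_tau algebra_simps power2_eq_square)

lemma cmod_tau_sq: "(cmod \<tau>)\<^sup>2 = q"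
  using Im_tau_sq by (simp add: cmod_power2 Re_tau power_divide)

lemma cmod_tau: "cmod \<tau> = sqrt q"
  using cmod_tau_sq by (metis norm_ge_zero real_sqrt_unique)

lemma tau_nz: "\<tau> \<noteq> 0"
  using Im_tau_nz by auto

lemma cmod_tau_power_sq: "(cmod (\<tau> ^ n))\<^sup>2 = real q ^ n"
  by (simp add: norm_power power_mult_distrib flip: power_mult cmod_tau_sq)
     (simp add: mult.commute)

lemma Ztau_eq_iff:
  "of_int a + of_int b * \<tau> = of_int c + of_int d * \<tau> \<longleftrightarrow> a = c \<and> b = d"
proof
  assume eq: "of_int a + of_int b * \<tau> = of_int c + of_int d * \<tau>"
  from arg_cong[OF eq, of Im] have "b = d" using Im_tau_nz by simp
  with eq show "a = c \<and> b = d" by simp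
qed auto

lemma Ztau_eq_0_iff: "of_int a + of_int b * \<tau> = 0 \<longleftrightarrow> a = 0 \<and> b = 0"
  using Ztau_eq_iff[of a b 0 0] by simp

lemma tau_times: "\<tau> * (of_int a + of_int b * \<tau>) = of_int (- int q * b) + of_int (a + p * b) * \<tau>"
proof -
  have "\<tau> * (of_int a + of_int b * \<tau>) = of_int a * \<tau> + of_int b * \<tau>\<^sup>2"
    by (simp add: algebra_simps power2_eq_square)
  also have "\<tau>\<^sup>2 = of_int p * \<tau> - of_nat q" using tau_eq by (simp add: algebra_simps)
  also have "of_int a * \<tau> + of_int b * (of_int p * \<tau> - of_nat q)
      = of_int (- int q * b) + of_int (a + p * b) * \<tau>"
    by (simp add: algebra_simps)
  finally show ?thesis .
qed

lemma Ztau_cases: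
  assumes "z \<in> Ztau \<tau>"
  obtains a b where "z = of_int a + of_int b * \<tau>"
  using assms by (auto simp: Ztau_def)

lemma in_Ztau [simp, intro]: "of_int a + of_int b * \<tau> \<in> Ztau \<tau>"
  by (auto simp: Ztau_def)

lemma Ztau_of_int [simp, intro]: "of_int a \<in> Ztau \<tau>"
  using in_Ztau[of a 0] by simp

lemma Ztau_of_nat [simp, intro]: "of_nat a \<in> Ztau \<tau>"
  using Ztau_of_int[of "int a"] by simp

lemma Ztau_01 [simp, intro]: "0 \<in> Ztau \<tau>" "1 \<in> Ztau \<tau>"
  using Ztau_of_int[of 0] Ztau_of_int[of 1] by auto

lemma Ztau_tau [simp, intro]: "\<tau> \<in> Ztau \<tau>"
  using in_Ztau[of 0 1] by simp

lemma Ztau_add [intro]: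
  assumes "x \<in> Ztau \<tau>" "y \<in> Ztau \<tau>"
  shows "x + y \<in> Ztau \<tau>"
proof -
  obtain a b where x: "x = of_int a + of_int b * \<tau>" using assms(1) by (rule Ztau_cases)
  obtain c d where y: "y = of_int c + of_int d * \<tau>" using assms(2) by (rule Ztau_cases)
  have "x + y = of_int (a + c) + of_int (b + d) * \<tau>" by (simp add: x y algebra_simps)
  then show ?thesis by (simp only: in_Ztau)
qed

lemma Ztau_uminus [intro]:
  assumes "x \<in> Ztau \<tau>"
  shows "- x \<in> Ztau \<tau>"
proof -
  obtain a b where x: "x = of_int a + of_int b * \<tau>" using assms by (rule Ztau_cases)
  have "- x = of_int (- a) + of_int (- b) * \<tau>" by (simp add: x)
  then show ?thesis by (simp only: in_Ztau)
qed

lemma Ztau_diff [intro]: "x \<in> Ztau \<tau> \<Longrightarrow> y \<in> Ztau \<tau> \<Longrightarrow> x - y \<in> Ztau \<tau>"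
  using Ztau_add[of x "- y"] Ztau_uminus[of y] by simp

lemma Ztau_mult [intro]:
  assumes "x \<in> Ztau \<tau>" "y \<in> Ztau \<tau>"
  shows "x * y \<in> Ztau \<tau>"
proof -
  obtain a b where x: "x = of_int a + of_int b * \<tau>" using assms(1) by (rule Ztau_cases)
  obtain c d where y: "y = of_int c + of_int d * \<tau>" using assms(2) by (rule Ztau_cases)
  have "x * y = of_int a * y + of_int b * (\<tau> * y)" by (simp add: x algebra_simps)
  also have "\<tau> * y = of_int (- int q * d) + of_int (c + p * d) * \<tau>"
    unfolding y by (rule tau_times)
  also have "of_int a * y + of_int b * (of_int (- int q * d) + of_int (c + p * d) * \<tau>)
      = of_int (a * c - b * int q * d) + of_int (a * d + b * (c + p * d)) * \<tau>"
    by (simp add: y algebra_simps)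
  finally show ?thesis by (simp only: in_Ztau)
qed

lemma Ztau_power [intro]: "x \<in> Ztau \<tau> \<Longrightarrow> x ^ n \<in> Ztau \<tau>"
  by (induction n) auto

lemma Ztau_cnj:
  assumes "x \<in> Ztau \<tau>"
  shows "cnj x \<in> Ztau \<tau>"
proof -
  obtain a b where x: "x = of_int a + of_int b * \<tau>" using assms by (rule Ztau_cases)
  show ?thesis unfolding x by (auto simp: cnj_tau)
qed

text \<open>By \<open>tau_times\<close>, multiples of \<open>\<tau>\<close> are exactly the elements
  whose constant coordinate is a multiple of \<open>q\<close>; reduction modulo
  \<open>\<tau>\<close> is reduction of \<open>a\<close> modulo \<open>q\<close>.\<close>

lemma tau_dvd_iff: "Ztau_dvd \<tau> \<tau> (of_int a + of_int b * \<tau>) \<longleftrightarrow> int q dvd a"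
proof
  assume "Ztau_dvd \<tau> \<tau> (of_int a + of_int b * \<tau>)"
  then obtain y where y: "y \<in> Ztau \<tau>" "of_int a + of_int b * \<tau> = \<tau> * y"
    by (auto simp: Ztau_dvd_def)
  from y(1) obtain c d where yd: "y = of_int c + of_int d * \<tau>" by (rule Ztau_cases)
  have "a = - int q * d"
    using y(2) unfolding yd tau_times Ztau_eq_iff by simp
  then show "int q dvd a" by simp
next
  assume "int q dvd a"
  then obtain d where d: "a = int q * d" by (elim dvdE)
  have "of_int a + of_int b * \<tau> = \<tau> * (of_int (b + p * d) + of_int (- d) * \<tau>)"
    unfolding tau_times by (simp add: d)
  then show "Ztau_dvd \<tau> \<tau> (of_int a + of_int b * \<tau>)"
    unfolding Ztau_dvd_def by blast
qed

lemma tau_dvd_mult: "x \<in> Ztau \<tau> \<Longrightarrow> Ztau_dvd \<tau> \<tau> (\<tau> * x)"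
  by (auto simp: Ztau_dvd_def)

lemma tau_dvd_diff:
  assumes "Ztau_dvd \<tau> \<tau> x" "Ztau_dvd \<tau> \<tau> y"
  shows "Ztau_dvd \<tau> \<tau> (x - y)"
proof -
  from assms obtain a b where "a \<in> Ztau \<tau>" "x = \<tau> * a" "b \<in> Ztau \<tau>" "y = \<tau> * b"
    by (auto simp: Ztau_dvd_def)
  then have "a - b \<in> Ztau \<tau>" "x - y = \<tau> * (a - b)" by (auto simp: algebra_simps)
  then show ?thesis unfolding Ztau_dvd_def by blast
qed

lemma tau_dvd_uminus: "Ztau_dvd \<tau> \<tau> (- x) \<longleftrightarrow> Ztau_dvd \<tau> \<tau> x"
  using tau_dvd_diff[of 0 x] tau_dvd_diff[of 0 "- x"] tau_dvd_mult[of 0] by auto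

lemma tau_dvd_power: "0 < n \<Longrightarrow> Ztau_dvd \<tau> \<tau> (\<tau> ^ n)"
  using tau_dvd_mult[of "\<tau> ^ (n - 1)"] by (cases n) auto

lemma not_tau_dvd_1: "\<not> Ztau_dvd \<tau> \<tau> 1"
  using tau_dvd_iff[of 1 0] q_ge_2 by auto

lemma cmod_sq_Ztau:
  "(cmod (of_int a + of_int b * \<tau>))\<^sup>2 = of_int (a\<^sup>2 + p * a * b + int q * b\<^sup>2)"
proof -
  have "(cmod (of_int a + of_int b * \<tau>))\<^sup>2 = (a + b * (p / 2))\<^sup>2 + b\<^sup>2 * (Im \<tau>)\<^sup>2"
    by (simp add: cmod_power2 Re_tau power_mult_distrib)
  also have "\<dots> = a\<^sup>2 + p * a * b + b\<^sup>2 * p\<^sup>2 / 4 + b\<^sup>2 * (real q - 1 / 4)"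
    unfolding Im_tau_sq by (simp add: power2_eq_square algebra_simps)
  also have "\<dots> = of_int (a\<^sup>2 + p * a * b + int q * b\<^sup>2)"
    by (simp add: algebra_simps)
  finally show ?thesis .
qed

lemma cmod_sq_int:
  assumes "z \<in> Ztau \<tau>"
  obtains n :: nat where "(cmod z)\<^sup>2 = n"
proof -
  obtain a b where z: "z = of_int a + of_int b * \<tau>" using assms by (rule Ztau_cases)
  have "(cmod z)\<^sup>2 = of_int (a\<^sup>2 + p * a * b + int q * b\<^sup>2)" unfolding z by (rule cmod_sq_Ztau)
  moreover have "0 \<le> a\<^sup>2 + p * a * b + int q * b\<^sup>2"
    using calculation by (metis of_int_0_le_iff zero_le_power2)
  ultimately show ?thesis using that[of "nat (a\<^sup>2 + p * a * b + int q * b\<^sup>2)"] by simp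
qed

lemma cmod_ge_1:
  assumes "z \<in> Ztau \<tau>" "z \<noteq> 0"
  shows "1 \<le> cmod z"
proof -
  obtain n :: nat where n: "(cmod z)\<^sup>2 = n" using assms(1) by (rule cmod_sq_int)
  with assms(2) have "1 \<le> (cmod z)\<^sup>2" by (cases n) auto
  then show ?thesis using power2_le_imp_le[of 1 "cmod z"] by simp
qed

subsection \<open>Existence of non-adjacent forms\<close>

text \<open>Strictness makes the quotients in \<open>ex_wNAF\<close> shrink. For
  \<open>q = 2\<close> and \<open>w = 2\<close> the modulus would be exactly 2.\<close>

lemma cmod_tau_power_gt_2:
  assumes "3 \<le> w"
  shows "2 < cmod (\<tau> ^ w)"
proof -
  have "(2::real) ^ 3 \<le> 2 ^ w" using assms by (intro power_increasing) auto
  also have "\<dots> \<le> real q ^ w" using real_q_ge_2 by (intro power_mono) auto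
  finally have "2\<^sup>2 < (cmod (\<tau> ^ w))\<^sup>2" unfolding cmod_tau_power_sq by simp
  then show ?thesis by (rule power2_less_imp_less) simp
qed

text \<open>Here and in names such as \<open>A_odd\<close>, odd means not divisible by
  \<open>\<tau>\<close>. For \<open>p\<close>, \<open>q\<close> and the Lucas numbers it is ordinary
  parity.\<close>

lemma odd_cong:
  assumes "0 < w" "Ztau_dvd \<tau> (\<tau> ^ w) (x - y)" "\<not> Ztau_dvd \<tau> \<tau> x"
  shows "\<not> Ztau_dvd \<tau> \<tau> y"
proof
  assume y: "Ztau_dvd \<tau> \<tau> y"
  from assms(2) obtain v where v: "v \<in> Ztau \<tau>" "x - y = \<tau> ^ w * v"
    by (auto simp: Ztau_dvd_def)
  have "\<tau> ^ w * v = \<tau> * (\<tau> ^ (w - 1) * v)" using assms(1) by (cases w) auto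
  then have "Ztau_dvd \<tau> \<tau> (x - y)"
    unfolding v(2) using v(1) by (metis tau_dvd_mult Ztau_mult Ztau_power Ztau_tau)
  from tau_dvd_diff[OF this] have "Ztau_dvd \<tau> \<tau> (x - y - - y)"
    using y tau_dvd_uminus by blast
  with assms(3) show False by simp
qed

lemma digit_cong:
  assumes "min_norm_digit_set \<tau> w D" "0 < w" "z \<in> Ztau \<tau>" "\<not> Ztau_dvd \<tau> \<tau> z"
  obtains d y where "d \<in> D" "d \<noteq> 0" "y \<in> Ztau \<tau>" "z = d + \<tau> ^ w * y" "cmod d \<le> cmod z"
proof -
  from assms obtain d where d: "d \<in> D" "Ztau_dvd \<tau> (\<tau> ^ w) (z - d)"
    unfolding min_norm_digit_set_def by blast
  then obtain y where y: "y \<in> Ztau \<tau>" "z - d = \<tau> ^ w * y" by (auto simp: Ztau_dvd_def)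
  have "d \<noteq> 0"
    using odd_cong[OF assms(2) d(2) assms(4)] tau_dvd_mult[of 0] by auto
  moreover from this d assms have "cmod d \<le> cmod z"
    unfolding min_norm_digit_set_def by blast
  ultimately show ?thesis using d(1) y by (intro that[of d y]) (auto simp: algebra_simps)
qed

text \<open>A strictly shortest element of its residue class must be the chosen representative,
  whichever choices were made in forming \<open>D\<close>.\<close>

lemma digit_criterion:
  assumes "min_norm_digit_set \<tau> w D" "0 < w" "z \<in> Ztau \<tau>" "\<not> Ztau_dvd \<tau> \<tau> z"
    and closest: "\<And>y. y \<in> Ztau \<tau> \<Longrightarrow> y \<noteq> 0 \<Longrightarrow> cmod z < cmod (z - y * \<tau> ^ w)"
  shows "z \<in> D"
proof -
  obtain d y where d: "d \<in> D" "y \<in> Ztau \<tau>" "z = d + \<tau> ^ w * y" "cmod d \<le> cmod z"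
    using assms(1-4) by (rule digit_cong)
  have "d = z - y * \<tau> ^ w" using d(3) by simp
  with closest[OF d(2)] d(4) have "y = 0" by force
  with d show ?thesis by simp
qed

text \<open>Optimality quantifies over the forms that exist, so refuting it requires an actual form.
  The induction is on the norm, which is a natural number.\<close>

lemma ex_wNAF:
  assumes D: "min_norm_digit_set \<tau> w D" and w: "3 \<le> w" and "z \<in> Ztau \<tau>"
  shows "\<exists>\<sigma>. wNAF \<tau> w D z \<sigma>"
proof -
  have D0: "0 \<in> D" using D by (simp add: min_norm_digit_set_def)
  have "\<exists>\<sigma>. wNAF \<tau> w D z \<sigma>" if "z \<in> Ztau \<tau>" "(cmod z)\<^sup>2 = real n" for n z
    using that
  proof (induction n arbitrary: z rule: less_induct)
    case (less n)
    have step: "\<exists>\<sigma>. wNAF \<tau> w D y \<sigma>" if "y \<in> Ztau \<tau>" "cmod y < cmod z" for y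
    proof -
      obtain m :: nat where m: "(cmod y)\<^sup>2 = m" using \<open>y \<in> Ztau \<tau>\<close> by (rule cmod_sq_int)
      have "(cmod y)\<^sup>2 < (cmod z)\<^sup>2" using that(2) by (intro power_strict_mono) auto
      with m less.prems(2) have "m < n" by simp
      from less.IH[OF this \<open>y \<in> Ztau \<tau>\<close> m] show ?thesis .
    qed
    consider "z = 0" | "z \<noteq> 0" "Ztau_dvd \<tau> \<tau> z" | "\<not> Ztau_dvd \<tau> \<tau> z" by blast
    then show ?case
    proof cases
      case 1
      with D0 show ?thesis by (auto intro: wNAF_zero)
    next
      case 2
      then obtain y where y: "y \<in> Ztau \<tau>" "z = \<tau> * y" by (auto simp: Ztau_dvd_def)
      have "1 < cmod \<tau>" using real_q_ge_2 by (simp add: cmod_tau)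
      then have "cmod y < cmod z" using y 2 by (simp add: norm_mult)
      from step[OF y(1) this] obtain \<sigma> where "wNAF \<tau> w D y \<sigma>" by blast
      from wNAF_prepend[OF this D0 D0, of 1] y show ?thesis by auto
    next
      case 3
      from w have "0 < w" by simp
      obtain d y where d: "d \<in> D" "y \<in> Ztau \<tau>" "z = d + \<tau> ^ w * y" "cmod d \<le> cmod z"
        by (rule digit_cong[OF D \<open>0 < w\<close> less.prems(1) 3])
      have "z \<noteq> 0" using 3 tau_dvd_mult[of 0] by auto
      have "\<exists>\<sigma>. wNAF \<tau> w D y \<sigma>"
      proof (cases "y = 0")
        case False
        \<comment> \<open>The digit is no longer than \<open>z\<close>, so
          \<open>\<tau> ^ w * y = z - d\<close> has length at most twice that of \<open>z\<close>,
          while \<open>\<tau> ^ w\<close> is longer than 2.\<close>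
        have "cmod (\<tau> ^ w * y) \<le> 2 * cmod z"
          using norm_triangle_ineq4[of z d] d(3,4) by simp
        moreover have "2 * cmod y < cmod (\<tau> ^ w) * cmod y"
          using cmod_tau_power_gt_2[OF w] False by simp
        ultimately show ?thesis using step[OF d(2)] by (simp add: norm_mult)
      qed (use D0 in \<open>auto intro: wNAF_zero\<close>)
      then obtain \<sigma> where "wNAF \<tau> w D y \<sigma>" by blast
      from wNAF_prepend[OF this d(1) D0, of w] w d(3) show ?thesis by auto
    qed
  qed
  with assms(3) show ?thesis by (metis cmod_sq_int)
qed

section \<open>Comparison of weights\<close>

lemma odd_weight_le_1:
  assumes "digit_expansion \<tau> D z \<sigma>" "D \<subseteq> Ztau \<tau>" "\<not> Ztau_dvd \<tau> \<tau> z" "weight \<sigma> \<le> 1"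
  shows "z \<in> D"
proof -
  let ?S = "{l. \<sigma> l \<noteq> 0}"
  note S = digit_expansion_support[OF assms(1)]
  have "?S \<noteq> {}"
  proof
    assume "?S = {}"
    with S(2) have "z = 0" by (metis sum.empty)
    with assms(3) tau_dvd_mult[of 0] show False by auto
  qed
  with S(1) have "card ?S \<noteq> 0" by simp
  with assms(4) have "card ?S = 1" unfolding weight_def by linarith
  then obtain j where j: "?S = {j}" by (auto simp: card_1_singleton_iff)
  have zj: "z = \<sigma> j * \<tau> ^ j" using S(2) unfolding j by simp
  have sj: "\<sigma> j \<in> D" using assms(1) by (simp add: digit_expansion_def)
  \<comment> \<open>A single term at a positive position would be divisible by
    \<open>\<tau>\<close>.\<close>
  have "j = 0"
  proof (rule ccontr)
    assume "j \<noteq> 0"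
    then have "z = \<tau> * (\<sigma> j * \<tau> ^ (j - 1))" unfolding zj by (cases j) auto
    moreover have "\<sigma> j * \<tau> ^ (j - 1) \<in> Ztau \<tau>" using sj assms(2) by auto
    ultimately show False using assms(3) tau_dvd_mult by metis
  qed
  with zj sj show ?thesis by simp
qed

text \<open>\<open>?\<sigma>\<close> is \<open>C\<close> followed at distance \<open>w\<close> by a
  form of \<open>E\<close>, which has weight at least two because \<open>E\<close> is neither a
  digit nor divisible by \<open>\<tau>\<close>. \<open>?\<rho>\<close> writes the same element with
  just \<open>A\<close> and \<open>B\<close>.\<close>

lemma not_optimal:
  assumes D: "min_norm_digit_set \<tau> w D" and w: "3 \<le> w"
    and digits: "A \<in> D" "B \<in> D" "C \<in> D" "A \<noteq> 0" "B \<noteq> 0" "C \<noteq> 0"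
    and E: "E \<in> Ztau \<tau>" "\<not> Ztau_dvd \<tau> \<tau> E" "E \<notin> D"
    and eq: "A + B * \<tau> ^ (w - 1) = C + \<tau> ^ w * E"
  shows "\<not> wNAF_optimal \<tau> w D"
proof
  assume opt: "wNAF_optimal \<tau> w D"
  have D': "0 \<in> D" "D \<subseteq> Ztau \<tau>" using D by (auto simp: min_norm_digit_set_def)
  obtain \<epsilon> where \<epsilon>: "wNAF \<tau> w D E \<epsilon>" using ex_wNAF[OF D w E(1)] by blast
  let ?z = "C + \<tau> ^ w * E" and ?\<sigma> = "prepend C w \<epsilon>"
  have \<sigma>: "wNAF \<tau> w D ?z ?\<sigma>" using wNAF_prepend[OF \<epsilon> digits(3) D'(1)] w by simp
  have "2 \<le> weight \<epsilon>"
  proof (rule ccontr)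
    assume "\<not> 2 \<le> weight \<epsilon>"
    then have "weight \<epsilon> \<le> 1" by simp
    with odd_weight_le_1[of D E \<epsilon>] \<epsilon> D' E show False by (simp add: wNAF_def)
  qed
  then have "3 \<le> weight ?\<sigma>"
    using weight_prepend[of \<tau> D E \<epsilon> C w] \<epsilon> digits w by (simp add: wNAF_def)
  have zero: "digit_expansion \<tau> D 0 (\<lambda>l. 0)" using wNAF_zero[OF D'(1)] by (simp add: wNAF_def)
  let ?\<beta> = "prepend B 1 (\<lambda>l. 0)"
  have \<beta>: "digit_expansion \<tau> D B ?\<beta>" using digit_expansion_prepend[OF zero digits(2) D'(1), of 1] by simp
  let ?\<rho> = "prepend A (w - 1) ?\<beta>"
  have "digit_expansion \<tau> D ?z ?\<rho>"
    using digit_expansion_prepend[OF \<beta> digits(1) D'(1), of "w - 1"] w eq by (simp add: mult.commute)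
  moreover have "?z \<in> Ztau \<tau>" using D' digits(3) E(1) by auto
  ultimately have "weight ?\<sigma> \<le> weight ?\<rho>"
    using opt \<sigma> unfolding wNAF_optimal_def optimal_expansion_def by blast
  also have "weight ?\<rho> = 2"
    using weight_prepend[OF \<beta> digits(4), of "w - 1"] weight_prepend[OF zero digits(5), of 1] w
    by (simp add: weight_def)
  finally show False using \<open>3 \<le> weight ?\<sigma>\<close> by simp
qed

end

subsection \<open>Crossing an edge of the Voronoi cell\<close>

lemma abs_of_int_le_square: "\<bar>real_of_int a\<bar> \<le> (real_of_int a)\<^sup>2"
proof (cases "a = 0")
  case False
  then have "1 \<le> \<bar>real_of_int a\<bar>" by linarith
  then have "\<bar>real_of_int a\<bar> ^ 1 \<le> \<bar>real_of_int a\<bar> ^ 2" by (intro power_increasing) auto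
  then show ?thesis by simp
qed simp

text \<open>
  Says that a point \<open>\<tau> x\<close> with \<open>2 Re x = \<theta>\<close> and small imaginary part of \<open>x\<close> lies in the interior of
  the Voronoi cell; the summand \<open>\<bar>a\<bar> / 4\<close> absorbs the imaginary part.
\<close>

lemma edge_inequality:
  fixes a b :: int and Q \<theta> :: real
  assumes "2 \<le> Q" "3 / 4 \<le> \<theta>" "\<theta> < 1" "a \<noteq> 0 \<or> b \<noteq> 0"
  shows "\<theta> * (a / 2 + Q * b) + \<bar>a\<bar> / 4 < a\<^sup>2 + a * b + Q * b\<^sup>2"
proof -
  define x where "x = real_of_int a"
  have x_sq: "\<bar>x\<bar> \<le> x\<^sup>2"
    unfolding x_def by (rule abs_of_int_le_square)
  have half: "\<theta> * x / 2 \<le> \<bar>x\<bar> / 2"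
  proof -
    have "\<theta> * x \<le> \<theta> * \<bar>x\<bar>" using assms by (intro mult_left_mono) auto
    also have "\<dots> \<le> 1 * \<bar>x\<bar>" using assms by (intro mult_right_mono) auto
    finally show ?thesis by simp
  qed
  consider "b = 0" | "b = 1" | "2 \<le> b" | "b \<le> -1" by linarith
  then have "\<theta> * (x / 2 + Q * b) + \<bar>x\<bar> / 4 < x\<^sup>2 + x * b + Q * b\<^sup>2"
  proof cases
    case 1
    then have "x \<noteq> 0" using assms by (simp add: x_def)
    with 1 half x_sq show ?thesis by simp
  next
    case 2
    \<comment> \<open>This is the tight case: at \<open>a = 0\<close>, \<open>b = 1\<close> only
      \<open>\<theta> < 1\<close> separates the two sides.\<close>
    have q: "\<theta> * Q < Q" using assms by simp
    have "\<theta> * x / 2 + \<bar>x\<bar> / 4 \<le> x\<^sup>2 + x"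
    proof (cases "x \<ge> 0")
      case True
      with half zero_le_power2[of x] show ?thesis by linarith
    next
      case False
      \<comment> \<open>For negative \<open>x\<close> the lower bound on \<open>\<theta>\<close>
        lets \<open>\<theta> * x / 2\<close> outweigh \<open>\<bar>x\<bar> / 4\<close>.\<close>
      then have "(\<theta> - 3 / 4) * x \<le> 0" using assms by (simp add: mult_le_0_iff)
      then have "\<theta> * x \<le> 3 / 4 * x" by (simp add: left_diff_distrib)
      with False x_sq show ?thesis by linarith
    qed
    with 2 q show ?thesis by (simp add: algebra_simps)
  next
    case 3
    define y where "y = real_of_int b"
    have y: "2 \<le> y" using 3 by (simp add: y_def)
    have "Q * (\<theta> * y) \<le> Q * y" using assms y by (intro mult_left_mono) auto
    moreover have "2 * (y\<^sup>2 - y) \<le> Q * y\<^sup>2 - Q * y"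
      using assms y unfolding right_diff_distrib[symmetric]
      by (intro mult_right_mono) (auto simp: power2_eq_square)
    moreover have "2 * y \<le> y\<^sup>2" using y by (simp add: power2_eq_square)
    moreover have "\<theta> * x / 2 - x * y + \<bar>x\<bar> / 4 \<le> \<bar>x\<bar> * y"
    proof (cases "x \<ge> 0")
      case True
      then have "x * 2 \<le> x * y" using y by (intro mult_left_mono) auto
      with half abs_of_nonneg[OF True] True show ?thesis by linarith
    next
      case False
      then have "(\<theta> - 3 / 4) * x \<le> 0" using assms by (simp add: mult_le_0_iff)
      then have "\<theta> * x \<le> 3 / 4 * x" by (simp add: left_diff_distrib)
      with False show ?thesis by simp
    qed
    moreover have "2 * (\<bar>x\<bar> * y) \<le> x\<^sup>2 + y\<^sup>2"
      using sum_squares_bound[of "\<bar>x\<bar>" y] by simp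
    moreover have "0 < y\<^sup>2" "0 \<le> x\<^sup>2" using y by auto
    ultimately have "\<theta> * x / 2 + Q * (\<theta> * y) + \<bar>x\<bar> / 4 < x\<^sup>2 + x * y + Q * y\<^sup>2"
      by argo
    then show ?thesis by (simp add: y_def algebra_simps)
  next
    case 4
    define k where "k = - real_of_int b"
    have k: "1 \<le> k" using 4 by (simp add: k_def)
    have "2 * (k\<^sup>2 + \<theta> * k) \<le> Q * (k\<^sup>2 + \<theta> * k)"
      using assms k by (intro mult_right_mono) auto
    moreover have "3 / 4 * k \<le> \<theta> * k" using assms k by (intro mult_right_mono) auto
    \<comment> \<open>Completes the square for \<open>\<bar>x\<bar> * (k + 3 / 4)\<close>, where 3/4
      is the 1/2 of \<open>half\<close> plus the 1/4 of the extra summand.\<close>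
    moreover have "0 \<le> (\<bar>x\<bar> - (k + 3 / 4) / 2)\<^sup>2" "1 \<le> k\<^sup>2" "x * k \<le> \<bar>x\<bar> * k"
      using k by (auto intro: mult_right_mono)
    then have "0 \<le> x\<^sup>2 - \<bar>x\<bar> * k - 3 / 4 * \<bar>x\<bar> + (k\<^sup>2 + 3 / 2 * k + 9 / 16) / 4" "1 \<le> k\<^sup>2" "x * k \<le> \<bar>x\<bar> * k"
      by (simp_all add: power2_eq_square algebra_simps)
    ultimately have "\<theta> * x / 2 + \<bar>x\<bar> / 4 < x\<^sup>2 - x * k + Q * (k\<^sup>2 + \<theta> * k)"
      using half k unfolding distrib_left by argo
    then show ?thesis by (simp add: k_def algebra_simps)
  qed
  then show ?thesis by (simp add: x_def)
qed

context trace_one_base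
begin

lemma Re_tau_cnj:
  "Re (\<tau> * cnj (of_int a + of_int b * \<tau>)) = of_int p * of_int a / 2 + real q * of_int b"
proof -
  have "Re (\<tau> * cnj (of_int a + of_int b * \<tau>)) = Re \<tau> * of_int a + of_int b * ((Re \<tau>)\<^sup>2 + (Im \<tau>)\<^sup>2)"
    by (simp add: power2_eq_square algebra_simps)
  then show ?thesis unfolding Im_tau_sq by (simp add: Re_tau power_divide)
qed

lemma Im_tau_cnj: "Im (\<tau> * cnj (of_int a + of_int b * \<tau>)) = of_int a * Im \<tau>"
  by (simp add: algebra_simps)

text \<open>Expanding the squares in \<open>cmod x < cmod (x - y)\<close> for
  \<open>x = z / \<tau> ^ w\<close> gives the inequalities that define the interior of the Voronoi
  cell.\<close>

lemma digit_criterion_Re: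
  assumes "min_norm_digit_set \<tau> w D" "0 < w" "z \<in> Ztau \<tau>" "\<not> Ztau_dvd \<tau> \<tau> z"
    and "\<And>y. y \<in> Ztau \<tau> \<Longrightarrow> y \<noteq> 0 \<Longrightarrow> 2 * Re (z / \<tau> ^ w * cnj y) < (cmod y)\<^sup>2"
  shows "z \<in> D"
proof (rule digit_criterion[OF assms(1-4)])
  fix y assume y: "y \<in> Ztau \<tau>" "y \<noteq> 0"
  define x where "x = z / \<tau> ^ w"
  have z: "z = x * \<tau> ^ w" using tau_nz by (simp add: x_def)
  have "(cmod (x - y))\<^sup>2 = (cmod x)\<^sup>2 - 2 * Re (x * cnj y) + (cmod y)\<^sup>2"
    unfolding cmod_power2 by (simp add: power2_eq_square algebra_simps)
  with assms(5)[OF y] have "(cmod x)\<^sup>2 < (cmod (x - y))\<^sup>2" by (simp add: x_def)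
  then have "cmod x < cmod (x - y)" by (rule power2_less_imp_less) simp
  then have "cmod (x * \<tau> ^ w) < cmod ((x - y) * \<tau> ^ w)"
    using tau_nz by (simp add: norm_mult)
  then show "cmod z < cmod (z - y * \<tau> ^ w)" by (simp add: z algebra_simps)
qed

text \<open>
  The last condition places \<open>u / \<tau>\<close> well inside \<open>2 V\<close>, which makes it the difference of two
  interior points \<open>\<plusminus> u / (2 \<tau>)\<close> of \<open>V\<close>.
\<close>

definition good_shift :: "complex \<Rightarrow> bool" where
  "good_shift u \<longleftrightarrow> u \<in> Ztau \<tau> \<and> \<not> Ztau_dvd \<tau> \<tau> u \<and> cmod (u / \<tau>) \<le> sqrt q \<and>
     (\<forall>y\<in>Ztau \<tau>. \<bar>Re (u / \<tau> * cnj y)\<bar> \<le> (1 - 1 / (8 * q)) * (cmod y)\<^sup>2)"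

lemma good_shift_uminus: "good_shift u \<Longrightarrow> good_shift (- u)"
  by (auto simp: good_shift_def tau_dvd_uminus)

lemma sqrt_q: "1 \<le> sqrt q" "sqrt q \<le> q" "sqrt q * sqrt q = q" "4 / 3 \<le> sqrt q"
proof -
  show "sqrt q * sqrt q = q" by simp
  have "(4 / 3)\<^sup>2 \<le> real q" using real_q_ge_2 by (simp add: power2_eq_square)
  then show "4 / 3 \<le> sqrt q" by (rule real_le_rsqrt)
  then show *: "1 \<le> sqrt q" by linarith
  then have "sqrt q * 1 \<le> sqrt q * sqrt q" by (intro mult_left_mono) auto
  then show "sqrt q \<le> q" by simp
qed

text \<open>Take \<open>A\<close> to be a lattice point near half of
  \<open>S = u * \<tau> ^ (w - 1)\<close>, so that \<open>C = A - S\<close> is near the negative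
  half. Since \<open>S / \<tau> ^ w = u / \<tau>\<close>, the margin in \<open>good_shift\<close>
  keeps both in the interior of the scaled cell.\<close>

lemma shift_decomposition:
  assumes D: "min_norm_digit_set \<tau> w D" and w: "3 \<le> w"
    and large: "64 * (real q)\<^sup>2 \<le> cmod (\<tau> ^ w)" and u: "good_shift u"
  obtains A C where "A \<in> D" "C \<in> D" "A \<noteq> 0" "C \<noteq> 0" "A - C = u * \<tau> ^ (w - 1)"
proof -
  define T where "T = \<tau> ^ w"
  define S where "S = u * \<tau> ^ (w - 1)"
  have T: "T = \<tau> * \<tau> ^ (w - 1)" using w by (cases w) (auto simp: T_def)
  have "T \<noteq> 0" using tau_nz by (simp add: T_def)
  have u': "u \<in> Ztau \<tau>" using u by (simp add: good_shift_def)
  then have S: "S \<in> Ztau \<tau>" by (auto simp: S_def)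
  have ST: "S / T = u / \<tau>" using tau_nz by (simp add: S_def T)
  have S_even: "Ztau_dvd \<tau> \<tau> S"
  proof -
    have "S = \<tau> * (u * \<tau> ^ (w - 2))"
    proof -
      have "w - 1 = Suc (w - 2)" using w by simp
      then show ?thesis by (simp add: S_def)
    qed
    moreover have "u * \<tau> ^ (w - 2) \<in> Ztau \<tau>" using u' by auto
    ultimately show ?thesis by (metis tau_dvd_mult)
  qed
  obtain c d where cd: "S = of_int c + of_int d * \<tau>" using S by (rule Ztau_cases)
  define A0 where "A0 = of_int (c div 2) + of_int (d div 2) * \<tau>"
  \<comment> \<open>\<open>A0\<close> and \<open>A0 + 1\<close> cannot both be divisible by
    \<open>\<tau>\<close>. As \<open>S\<close> is divisible by \<open>\<tau>\<close>, the property
    passes from \<open>A\<close> to \<open>A - S\<close>.\<close>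
  define A where "A = (if Ztau_dvd \<tau> \<tau> A0 then A0 + 1 else A0)"
  have A0: "A0 \<in> Ztau \<tau>" unfolding A0_def by (rule in_Ztau)
  then have A: "A \<in> Ztau \<tau>" by (auto simp: A_def)
  have A_odd: "\<not> Ztau_dvd \<tau> \<tau> A"
    using tau_dvd_diff[of "A0 + 1" A0] not_tau_dvd_1 by (auto simp: A_def)
  have C_odd: "\<not> Ztau_dvd \<tau> \<tau> (A - S)"
  proof
    assume "Ztau_dvd \<tau> \<tau> (A - S)"
    from tau_dvd_diff[OF this, of "- S"] S_even A_odd show False by (simp add: tau_dvd_uminus)
  qed
  have halves: "\<bar>real_of_int (n div 2) - n / 2\<bar> \<le> 1 / 2" for n :: int
  proof -
    have "2 * (n div 2) + n mod 2 = n" "0 \<le> n mod 2" "n mod 2 < 2" by auto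
    then have "2 * real_of_int (n div 2) + real_of_int (n mod 2) = n"
        "0 \<le> real_of_int (n mod 2)" "real_of_int (n mod 2) \<le> 1"
      by (metis of_int_add of_int_mult of_int_numeral, auto)
    then show ?thesis by (simp add: abs_le_iff field_simps)
  qed
  define e where "e = A - S / 2"
  have "cmod e \<le> 2 * sqrt q"
  proof -
    have "A0 - S / 2 = of_real (real_of_int (c div 2) - c / 2) + of_real (real_of_int (d div 2) - d / 2) * \<tau>"
      by (simp add: A0_def cd algebra_simps add_divide_distrib)
    then have "cmod (A0 - S / 2) \<le> \<bar>real_of_int (c div 2) - c / 2\<bar> + \<bar>real_of_int (d div 2) - d / 2\<bar> * sqrt q"
      by (metis norm_triangle_ineq norm_of_real norm_mult cmod_tau)
    also have "\<dots> \<le> 1 / 2 + 1 / 2 * sqrt q"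
      using halves by (intro add_mono mult_right_mono) auto
    finally have "cmod (A0 - S / 2) \<le> 1 / 2 + sqrt q / 2" by simp
    moreover have "cmod e \<le> cmod (A0 - S / 2) + 1"
    proof (cases "Ztau_dvd \<tau> \<tau> A0")
      case True
      then have "e = (A0 - S / 2) + 1" by (simp add: e_def A_def)
      then show ?thesis by (metis norm_triangle_ineq norm_one)
    qed (simp add: e_def A_def)
    ultimately show ?thesis using sqrt_q by simp
  qed
  then have eps: "cmod (e / T) \<le> 2 * sqrt q / cmod T"
    by (simp add: norm_divide divide_right_mono)
  \<comment> \<open>This is the size of \<open>T\<close> at which twice the relative rounding error
    falls below the margin \<open>1 / (8 * q)\<close>.\<close>
  have "32 * (real q * sqrt q) < 64 * (real q * real q)"
    using sqrt_q real_q_ge_2 by (smt (verit) mult_left_mono mult_pos_pos)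
  then have "32 * (real q * sqrt q) < cmod T"
    using large by (simp add: T_def power2_eq_square)
  then have small: "4 * sqrt q / cmod T < 1 / (8 * q)"
    using real_q_ge_2 \<open>T \<noteq> 0\<close> by (simp add: field_simps)
  have bound: "\<bar>Re (S / T * cnj y)\<bar> + 2 * \<bar>Re (e / T * cnj y)\<bar> < (cmod y)\<^sup>2"
    if y: "y \<in> Ztau \<tau>" "y \<noteq> 0" for y
  proof -
    have y1: "1 \<le> cmod y" using y by (rule cmod_ge_1)
    have "2 * \<bar>Re (e / T * cnj y)\<bar> \<le> 2 * (cmod (e / T) * cmod y)"
      using abs_Re_le_cmod[of "e / T * cnj y"] unfolding norm_mult complex_mod_cnj by linarith
    also have "\<dots> \<le> 2 * (2 * sqrt q / cmod T * cmod y)"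
      using eps by (intro mult_left_mono mult_right_mono) auto
    also have "\<dots> = 4 * sqrt q / cmod T * cmod y" by simp
    also have "\<dots> < 1 / (8 * q) * cmod y"
      using small y1 by (intro mult_strict_right_mono) auto
    also have "\<dots> \<le> 1 / (8 * q) * (cmod y)\<^sup>2"
      using y1 self_le_power[of "cmod y" 2] by (intro mult_left_mono) auto
    finally have "2 * \<bar>Re (e / T * cnj y)\<bar> < 1 / (8 * q) * (cmod y)\<^sup>2" .
    moreover have "\<bar>Re (S / T * cnj y)\<bar> \<le> (1 - 1 / (8 * q)) * (cmod y)\<^sup>2"
      using u y(1) by (simp only: ST good_shift_def)
    ultimately show ?thesis by (simp add: algebra_simps)
  qed
  have AT: "A / T = S / T / 2 + e / T" by (simp add: e_def diff_divide_distrib)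
  have CT: "(A - S) / T = - (S / T) / 2 + e / T" by (simp add: e_def diff_divide_distrib)
  have halved: "2 * Re ((s / 2 + f) * cnj y) = Re (s * cnj y) + 2 * Re (f * cnj y)"
    "2 * Re ((- s / 2 + f) * cnj y) = - Re (s * cnj y) + 2 * Re (f * cnj y)" for s f y
    by (simp_all add: algebra_simps)
  have "A \<in> D"
  proof (rule digit_criterion_Re[OF D _ A A_odd], goal_cases)
    case (2 y)
    have "2 * Re (A / T * cnj y) = Re (S / T * cnj y) + 2 * Re (e / T * cnj y)"
      unfolding AT by (rule halved)
    with bound[OF 2] show ?case unfolding T_def by linarith
  qed (use w in simp)
  moreover have "A - S \<in> D"
  proof (rule digit_criterion_Re[OF D _ _ C_odd], goal_cases)
    case (3 y)
    have "2 * Re ((A - S) / T * cnj y) = - Re (S / T * cnj y) + 2 * Re (e / T * cnj y)"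
      unfolding CT by (rule halved)
    with bound[OF 3] show ?case unfolding T_def by linarith
  qed (use w A S in auto)
  moreover have "A \<noteq> 0" "A - S \<noteq> 0"
    using A_odd C_odd tau_dvd_mult[of 0] by auto
  ultimately show ?thesis using that[of A "A - S"] by (simp add: S_def)
qed

text \<open>\<open>B / \<tau> ^ w\<close> is close to \<open>\<tau> / 2\<close>, the midpoint of the
  cell edge on the bisector of 0 and \<open>\<tau>\<close>; \<open>Re e < 0\<close> puts it on the
  inner side.\<close>

lemma edge_digit:
  assumes D: "min_norm_digit_set \<tau> w D" and w: "0 < w"
    and B: "B \<in> Ztau \<tau>" "\<not> Ztau_dvd \<tau> \<tau> B" "B = \<tau> * (1 / 2 + e) * \<tau> ^ w"
    and e: "Re e < 0" "cmod e \<le> 1 / (8 * sqrt q)"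
  shows "B \<in> D"
proof (rule digit_criterion_Re[OF D w B(1,2)])
  fix y assume y: "y \<in> Ztau \<tau>" "y \<noteq> 0"
  obtain a b where ab: "y = of_int a + of_int b * \<tau>" using y(1) by (rule Ztau_cases)
  have nz: "p * a \<noteq> 0 \<or> b \<noteq> 0" using y(2) p_unit by (auto simp: ab)
  have "1 / (8 * sqrt q) \<le> 1 / 8" using sqrt_q by (simp add: field_simps)
  then have \<theta>: "3 / 4 \<le> 1 + 2 * Re e"
    using abs_Re_le_cmod[of e] e by linarith
  have Im_le: "\<bar>Im \<tau>\<bar> \<le> sqrt q" using abs_Im_le_cmod[of \<tau>] by (simp add: cmod_tau)
  have "\<bar>Im e * (a * Im \<tau>)\<bar> \<le> \<bar>a\<bar> / 8"
  proof -
    \<comment> \<open>The bound on \<open>e\<close> is chosen so that the displacement along the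
      edge costs, after doubling, exactly the \<open>\<bar>a\<bar> / 4\<close> of
      \<open>edge_inequality\<close>.\<close>
    have "\<bar>Im e\<bar> * \<bar>Im \<tau>\<bar> \<le> 1 / (8 * sqrt q) * sqrt q"
      using abs_Im_le_cmod[of e] e(2) Im_le by (intro mult_mono) auto
    also have "\<dots> = 1 / 8" using sqrt_q(1) by simp
    finally have "\<bar>a\<bar> * (\<bar>Im e\<bar> * \<bar>Im \<tau>\<bar>) \<le> \<bar>a\<bar> * (1 / 8)" by (intro mult_left_mono) auto
    then show ?thesis by (simp add: abs_mult mult_ac)
  qed
  moreover have "2 * Re (B / \<tau> ^ w * cnj y)
      = (1 + 2 * Re e) * Re (\<tau> * cnj y) - 2 * (Im e * Im (\<tau> * cnj y))"
  proof -
    have "B / \<tau> ^ w * cnj y = (1 / 2 + e) * (\<tau> * cnj y)" using tau_nz by (simp add: B(3))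
    then show ?thesis by (simp add: algebra_simps)
  qed
  ultimately have "2 * Re (B / \<tau> ^ w * cnj y)
      \<le> (1 + 2 * Re e) * (of_int p * of_int a / 2 + real q * of_int b) + \<bar>a\<bar> / 4"
    unfolding ab Re_tau_cnj Im_tau_cnj by linarith
  \<comment> \<open>Replacing \<open>a\<close> by \<open>p * a\<close> absorbs the sign
    \<open>p\<close>, since \<open>edge_inequality\<close> treats the norm form of trace 1.\<close>
  also have "\<dots> = (1 + 2 * Re e) * (real_of_int (p * a) / 2 + real q * of_int b) + real_of_int \<bar>p * a\<bar> / 4"
    using p_unit by (auto simp: abs_mult)
  also have "\<dots> < of_int ((p * a)\<^sup>2) + of_int (p * a * b) + real q * of_int (b\<^sup>2)"
    using edge_inequality[OF real_q_ge_2 \<theta> _ nz] e(1) by simp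
  also have "\<dots> = (cmod y)\<^sup>2"
    unfolding ab cmod_sq_Ztau by (simp add: power_mult_distrib)
  finally show "2 * Re (B / \<tau> ^ w * cnj y) < (cmod y)\<^sup>2" .
qed

lemma Re_mult_cnj_eq: "Re (z / t) * (cmod t)\<^sup>2 = Re (z * cnj t)" for z t :: complex
  by (cases "t = 0") (simp_all add: Re_divide cmod_power2)

text \<open>The first two conditions on \<open>F\<close> say that \<open>E\<close> lies beyond the
  bisector of 0 and \<open>\<tau> ^ w\<close>, while \<open>E - u / \<tau>\<close> lies before it.
  Hence \<open>E - \<tau> ^ w\<close> is shorter than \<open>E\<close>, yet
  \<open>B = \<tau> * E - u\<close> is a digit by \<open>edge_digit\<close>. The last condition
  keeps \<open>B\<close> near the midpoint of its edge.\<close>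

lemma not_optimal_beyond_edge:
  assumes D: "min_norm_digit_set \<tau> w D" and w: "3 \<le> w"
    and large: "64 * (real q)\<^sup>2 \<le> cmod (\<tau> ^ w)" and u: "good_shift u"
    and E: "E \<in> Ztau \<tau>" "\<not> Ztau_dvd \<tau> \<tau> E" "E = \<tau> ^ w / 2 + F"
    and F: "0 < Re (F * cnj (\<tau> ^ w))" "Re (F * cnj (\<tau> ^ w)) < Re (u / \<tau> * cnj (\<tau> ^ w))"
      "cmod F \<le> cmod (\<tau> ^ w) / (16 * sqrt q)"
  shows "\<not> wNAF_optimal \<tau> w D"
proof -
  define T where "T = \<tau> ^ w"
  have "T \<noteq> 0" using tau_nz by (simp add: T_def)
  have T: "T = \<tau> * \<tau> ^ (w - 1)" using w by (cases w) (auto simp: T_def)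
  have u': "u \<in> Ztau \<tau>" "\<not> Ztau_dvd \<tau> \<tau> u" "cmod (u / \<tau>) \<le> sqrt q"
    using u by (simp_all add: good_shift_def)
  obtain A C where AC: "A \<in> D" "C \<in> D" "A \<noteq> 0" "C \<noteq> 0" "A - C = u * \<tau> ^ (w - 1)"
    using D w large u by (rule shift_decomposition)
  define B where "B = \<tau> * E - u"
  have B: "B \<in> Ztau \<tau>" using E(1) u' by (auto simp: B_def)
  have B_odd: "\<not> Ztau_dvd \<tau> \<tau> B"
    using tau_dvd_diff[OF tau_dvd_mult[OF E(1)], of B] u'(2) by (auto simp: B_def)
  define e where "e = (F - u / \<tau>) / T"
  have "B \<in> D"
  proof (rule edge_digit[OF D _ B B_odd])
    show "B = \<tau> * (1 / 2 + e) * \<tau> ^ w"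
      using tau_nz \<open>T \<noteq> 0\<close> unfolding B_def E(3) e_def by (simp add: field_simps flip: T_def)
    have "Re e * (cmod T)\<^sup>2 < 0"
      using F(2) unfolding e_def Re_mult_cnj_eq T_def by (simp add: left_diff_distrib)
    then show "Re e < 0" using zero_le_power2[of "cmod T"] by (simp add: mult_less_0_iff)
    have "16 * real q * 1 \<le> 16 * real q * (4 * real q)" using real_q_ge_2 by (intro mult_left_mono) auto
    with large have "16 * real q \<le> cmod T" by (simp add: T_def power2_eq_square)
    moreover define r where "r = sqrt q"
    ultimately have "1 \<le> r" "16 * (r * r) \<le> cmod T" using sqrt_q by simp_all
    then have "r / cmod T \<le> 1 / (16 * r)"
      using \<open>T \<noteq> 0\<close> by (simp add: divide_le_eq le_divide_eq mult_ac)
    then have "sqrt q / cmod T \<le> 1 / (16 * sqrt q)" by (simp add: r_def)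
    moreover have "cmod F / cmod T \<le> 1 / (16 * sqrt q)"
      using F(3) \<open>T \<noteq> 0\<close> by (simp add: T_def divide_le_eq)
    moreover have "cmod e \<le> cmod F / cmod T + sqrt q / cmod T"
    proof -
      have "cmod (F - u / \<tau>) \<le> cmod F + sqrt q"
        using norm_triangle_ineq4[of F "u / \<tau>"] u'(3) by linarith
      then show ?thesis
        by (simp add: e_def norm_divide divide_right_mono flip: add_divide_distrib)
    qed
    ultimately show "cmod e \<le> 1 / (8 * sqrt q)" by (simp add: field_simps)
  qed (use w in simp)
  moreover have "B \<noteq> 0" using B_odd tau_dvd_mult[of 0] by auto
  moreover have "E \<notin> D"
  proof
    assume "E \<in> D"
    have "E \<noteq> 0" using E(2) tau_dvd_mult[of 0] by auto
    have "Ztau_dvd \<tau> (\<tau> ^ w) (E - T - E)" unfolding Ztau_dvd_def T_def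
      by (rule bexI[of _ "-1"]) (auto intro: Ztau_uminus)
    moreover have "E - T \<in> Ztau \<tau>" using E(1) by (auto simp: T_def)
    ultimately have "cmod E \<le> cmod (E - T)"
      using D \<open>E \<in> D\<close> \<open>E \<noteq> 0\<close> unfolding min_norm_digit_set_def by blast
    then have "(cmod E)\<^sup>2 \<le> (cmod (E - T))\<^sup>2" by (intro power_mono) auto
    with F(1) show False
      unfolding E(3) T_def[symmetric] cmod_power2 by (simp add: power2_eq_square algebra_simps)
  qed
  moreover have "A + B * \<tau> ^ (w - 1) = C + \<tau> ^ w * E"
    using AC(5) by (simp add: B_def T flip: T_def) (simp add: algebra_simps)
  ultimately show ?thesis using not_optimal[OF D w] AC E by blast
qed

section \<open>Admissible carries\<close>

text \<open>Equivalent to \<open>\<tau> / 2\<close> and its negative lying in the Voronoi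
  cell.\<close>

lemma abs_Re_tau:
  assumes "y \<in> Ztau \<tau>"
  shows "\<bar>Re (\<tau> * cnj y)\<bar> \<le> (cmod y)\<^sup>2"
proof -
  have *: "Re (\<tau> * cnj y) \<le> (cmod y)\<^sup>2" if y: "y \<in> Ztau \<tau>" for y
  proof -
    obtain a b where ab: "y = of_int a + of_int b * \<tau>" using y by (rule Ztau_cases)
    define x where "x = real_of_int p * of_int a"
    have x: "x\<^sup>2 = (of_int a)\<^sup>2" by (simp add: x_def power_mult_distrib)
    \<comment> \<open>For integers this product is nonnegative, so \<open>q\<close> may be lowered
      to 2. Then \<open>b\<close> in {0, 1} is settled by integrality of \<open>a\<close>, and every
      other \<open>b\<close> by completing a square.\<close>
    have "0 \<le> b * (b - 1)" by (cases "b \<ge> 1") (auto simp: mult_nonpos_nonpos)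
    then have b: "0 \<le> real_of_int b * (of_int b - 1)"
      by (metis of_int_0_le_iff of_int_1 of_int_diff of_int_mult)
    then have qb: "2 * (real_of_int b * (of_int b - 1)) \<le> q * (real_of_int b * (of_int b - 1))"
      using real_q_ge_2 by (intro mult_right_mono) auto
    have "0 \<le> x\<^sup>2 + x * (of_int b - 1 / 2) + 2 * (real_of_int b * (of_int b - 1))"
    proof (cases "b = 0 \<or> b = 1")
      case True
      have "\<bar>x\<bar> = \<bar>of_int a\<bar>" unfolding x_def using p_unit by (auto simp: abs_mult)
      then have "\<bar>x\<bar> \<le> x\<^sup>2" unfolding x by (simp only: abs_of_int_le_square)
      moreover have "x * (of_int b - 1 / 2) = - x / 2 \<or> x * (of_int b - 1 / 2) = x / 2"
        "real_of_int b * (of_int b - 1) = 0"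
        using True by auto
      ultimately show ?thesis by (smt (verit) field_sum_of_halves)
    next
      case False
      then have "b \<ge> 2 \<or> b \<le> -1" by linarith
      then have "1 \<le> b * (b - 1)"
      proof
        assume "2 \<le> b"
        then have "1 * 1 \<le> b * (b - 1)" by (intro mult_mono) auto
        then show ?thesis by simp
      next
        assume "b \<le> -1"
        then have "1 * 1 \<le> (- b) * (1 - b)" by (intro mult_mono) auto
        then show ?thesis by (simp add: algebra_simps)
      qed
      then have "1 \<le> real_of_int b * (of_int b - 1)"
        by (metis of_int_1 of_int_1_le_iff of_int_diff of_int_mult)
      moreover have "0 \<le> (x + (of_int b - 1 / 2) / 2)\<^sup>2" by simp
      then have "0 \<le> x\<^sup>2 + x * (of_int b - 1 / 2) + (real_of_int b * (of_int b - 1) + 1 / 4) / 4"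
        by (simp add: power2_eq_square algebra_simps)
      ultimately show ?thesis by argo
    qed
    with qb have "0 \<le> x\<^sup>2 + x * (of_int b - 1 / 2) + q * (real_of_int b * (of_int b - 1))"
      by argo
    then show ?thesis
      unfolding ab Re_tau_cnj cmod_sq_Ztau using x
      by (simp add: x_def power2_eq_square algebra_simps)
  qed
  from *[OF assms] *[of "- y"] assms Ztau_uminus show ?thesis by (simp add: abs_le_iff)
qed

lemma abs_Re_cnj_tau:
  assumes "y \<in> Ztau \<tau>"
  shows "\<bar>Re (cnj \<tau> * cnj y)\<bar> \<le> (cmod y)\<^sup>2"
  using abs_Re_tau[OF Ztau_cnj[OF assms]] by simp

text \<open>\<open>k / \<tau>\<close> is \<open>k / q\<close> times \<open>cnj \<tau>\<close>, whose
  half lies in the cell; the factor is at most \<open>1 - 1 / q\<close>, which supplies the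
  margin.\<close>

lemma good_shiftI_int:
  assumes k: "0 < k" "k < q"
  shows "good_shift (of_nat k)"
  unfolding good_shift_def
proof (intro conjI ballI)
  have kt: "of_nat k / \<tau> = of_real (k / q) * cnj \<tau>"
    using tau_nz tau_cnj q_ge_2 by (simp add: field_simps)
  show "\<not> Ztau_dvd \<tau> \<tau> (of_nat k)"
    using tau_dvd_iff[of "int k" 0] k by (auto dest: dvd_imp_le)
  have "k / q * sqrt q \<le> 1 * sqrt q" using k by (intro mult_right_mono) auto
  then show "cmod (of_nat k / \<tau>) \<le> sqrt q"
    unfolding kt norm_mult norm_of_real by (simp add: cmod_tau)
  fix y assume "y \<in> Ztau \<tau>"
  have "\<bar>Re (of_nat k / \<tau> * cnj y)\<bar> = k / q * \<bar>Re (cnj \<tau> * cnj y)\<bar>"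
  proof -
    have "Re (of_real c * z) = c * Re z" for c z by simp
    then show ?thesis unfolding kt mult.assoc by (simp only: abs_mult) simp
  qed
  also have "\<dots> \<le> k / q * (cmod y)\<^sup>2"
    using abs_Re_cnj_tau[OF \<open>y \<in> Ztau \<tau>\<close>] by (intro mult_left_mono) auto
  also have "\<dots> \<le> (1 - 1 / (8 * q)) * (cmod y)\<^sup>2"
  proof (rule mult_right_mono)
    have "real k + 1 \<le> q" using k by simp
    then show "k / q \<le> 1 - 1 / (8 * q)" using real_q_ge_2 by (simp add: field_simps)
  qed simp
  finally show "\<bar>Re (of_nat k / \<tau> * cnj y)\<bar> \<le> (1 - 1 / (8 * q)) * (cmod y)\<^sup>2" .
qed auto

text \<open>Here \<open>u / \<tau>\<close> is a proper convex combination of \<open>p\<close> and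
  \<open>\<tau>\<close>, with weight \<open>r = k / q\<close> at least 1/2 on \<open>p\<close>. The
  margin arises because no nonzero \<open>y\<close> is extremal for both end points.\<close>

lemma good_shiftI_tau_sq:
  assumes k: "k < q" "q \<le> 2 * k"
  shows "good_shift (of_nat k + \<tau>\<^sup>2)"
  unfolding good_shift_def
proof (intro conjI ballI)
  have u: "of_nat k + \<tau>\<^sup>2 = of_int (int k - int q) + of_int p * \<tau>"
    using tau_eq by (simp add: algebra_simps)
  then show "of_nat k + \<tau>\<^sup>2 \<in> Ztau \<tau>" by (simp only: in_Ztau)
  show "\<not> Ztau_dvd \<tau> \<tau> (of_nat k + \<tau>\<^sup>2)"
  proof
    assume "Ztau_dvd \<tau> \<tau> (of_nat k + \<tau>\<^sup>2)"
    then have "int q dvd int k - int q" unfolding u tau_dvd_iff .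
    from dvd_add[OF this dvd_refl] have "q dvd k" by simp
    with k q_ge_2 show False by (auto dest: dvd_imp_le)
  qed
  define r where "r = real k / q"
  have r: "1 / 2 \<le> r" "r \<le> 1 - 1 / q"
  proof -
    have "real q \<le> 2 * real k" "real k + 1 \<le> real q" using k by linarith+
    then show "1 / 2 \<le> r" "r \<le> 1 - 1 / q" using real_q_ge_2 by (simp_all add: r_def field_simps)
  qed
  have q8: "1 / (8 * q) \<le> 1 / q" "1 / (8 * q) \<le> 1 / 16" "0 < 1 / real q"
    using real_q_ge_2 by (simp_all add: field_simps)
  have r1: "0 < r" "r < 1" using r q8 by linarith+
  have s: "(of_nat k + \<tau>\<^sup>2) / \<tau> = of_real r * of_int p + of_real (1 - r) * \<tau>"
  proof -
    have "(of_nat k + \<tau>\<^sup>2) / \<tau> = of_nat k / \<tau> + \<tau>"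
      using tau_nz by (simp add: field_simps power2_eq_square)
    also have "of_nat k / \<tau> = of_real r * cnj \<tau>"
      using tau_nz tau_cnj q_ge_2 by (simp add: r_def field_simps)
    finally show ?thesis by (simp add: cnj_tau algebra_simps)
  qed
  have "cmod ((of_nat k + \<tau>\<^sup>2) / \<tau>) \<le> r * 1 + (1 - r) * sqrt q"
  proof -
    have "cmod ((of_nat k + \<tau>\<^sup>2) / \<tau>) \<le> cmod (of_real r * of_int p) + cmod (of_real (1 - r) * \<tau>)"
      unfolding s by (rule norm_triangle_ineq)
    also have "cmod (of_real r * of_int p) = r"
      using p_unit r(1) by (auto simp: norm_mult)
    also have "cmod (of_real (1 - r) * \<tau>) = (1 - r) * sqrt q"
      unfolding norm_mult norm_of_real cmod_tau using r1 by simp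
    finally show ?thesis by simp
  qed
  also have "\<dots> \<le> r * sqrt q + (1 - r) * sqrt q"
    using r1 sqrt_q by (intro add_right_mono mult_left_mono) auto
  finally show "cmod ((of_nat k + \<tau>\<^sup>2) / \<tau>) \<le> sqrt q" by (simp add: algebra_simps)
  fix y assume y: "y \<in> Ztau \<tau>"
  then obtain a b where ab: "y = of_int a + of_int b * \<tau>" by (rule Ztau_cases)
  have "Re ((of_nat k + \<tau>\<^sup>2) / \<tau> * cnj y) = r * (p * Re (cnj y)) + (1 - r) * Re (\<tau> * cnj y)"
    unfolding s by (simp add: algebra_simps)
  also have "\<bar>\<dots>\<bar> \<le> \<bar>r * (p * Re (cnj y))\<bar> + \<bar>(1 - r) * Re (\<tau> * cnj y)\<bar>"
    by (rule abs_triangle_ineq)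
  also have "\<bar>r * (p * Re (cnj y))\<bar> = r * \<bar>Re y\<bar>"
    using p_unit r(1) by (auto simp: abs_mult)
  also have "\<bar>(1 - r) * Re (\<tau> * cnj y)\<bar> = (1 - r) * \<bar>Re (\<tau> * cnj y)\<bar>"
    using r1 by (simp add: abs_mult)
  finally have le: "\<bar>Re ((of_nat k + \<tau>\<^sup>2) / \<tau> * cnj y)\<bar> \<le> r * \<bar>Re y\<bar> + (1 - r) * \<bar>Re (\<tau> * cnj y)\<bar>" .
  obtain n :: nat where n: "(cmod y)\<^sup>2 = n" using y by (rule cmod_sq_int)
  \<comment> \<open>Norm 1 forces \<open>y\<close> to be 1 or -1, where the \<open>\<tau>\<close>
    part loses a factor 2; from norm 2 on the \<open>p\<close> part loses a factor 3/4.\<close>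
  consider "n = 0" | "n = 1" | "2 \<le> n" by linarith
  then show "\<bar>Re ((of_nat k + \<tau>\<^sup>2) / \<tau> * cnj y)\<bar> \<le> (1 - 1 / (8 * q)) * (cmod y)\<^sup>2"
  proof cases
    case 1
    with n have "y = 0" by simp
    then show ?thesis by simp
  next
    case 2
    have "(a + p * b / 2)\<^sup>2 + (q - 1 / 4) * b\<^sup>2 = 1"
      using n 2 unfolding ab cmod_sq_Ztau
      by (simp add: power2_eq_square algebra_simps)
    moreover have "(7 / 4) * real_of_int (b\<^sup>2) \<le> (q - 1 / 4) * b\<^sup>2"
      using real_q_ge_2 by (intro mult_right_mono) auto
    moreover have "0 \<le> (a + p * b / 2)\<^sup>2" by simp
    ultimately have "real_of_int (b\<^sup>2) < 1" by linarith
    with abs_of_int_le_square[of b] have "\<bar>real_of_int b\<bar> < 1" by simp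
    then have "b = 0" by linarith
    with n 2 have "real_of_int (a\<^sup>2) = 1" unfolding ab cmod_sq_Ztau by simp
    then have "a = 1 \<or> a = -1" by (metis of_int_eq_1_iff power2_eq_1_iff)
    then have eqs: "\<bar>Re y\<bar> = 1" "\<bar>Re (\<tau> * cnj y)\<bar> = 1 / 2"
      unfolding ab Re_tau_cnj using p_unit \<open>b = 0\<close> by auto
    from le have "\<bar>Re ((of_nat k + \<tau>\<^sup>2) / \<tau> * cnj y)\<bar> \<le> r * 1 + (1 - r) * (1 / 2)"
      by (simp only: eqs)
    also have "\<dots> \<le> 1 - 1 / (8 * q)"
    proof -
      define c where "c = 1 / real q"
      have "1 / real (8 * q) = c / 8" by (simp add: c_def)
      moreover have "r \<le> 1 - c" "0 < c" using r q8 by (simp_all add: c_def)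
      ultimately show ?thesis by argo
    qed
    finally show ?thesis unfolding n 2 by simp
  next
    case 3
    have "(4 / 3)\<^sup>2 \<le> (cmod y)\<^sup>2" using 3 unfolding n by (simp add: power2_eq_square)
    then have "4 / 3 \<le> cmod y" by (rule power2_le_imp_le) simp
    then have "4 / 3 * cmod y \<le> cmod y * cmod y" by (intro mult_right_mono) auto
    then have "cmod y \<le> 3 / 4 * (cmod y)\<^sup>2" by (simp add: power2_eq_square)
    with abs_Re_le_cmod[of y] have "\<bar>Re y\<bar> \<le> 3 / 4 * (cmod y)\<^sup>2" by linarith
    then have "r * \<bar>Re y\<bar> \<le> r * (3 / 4 * (cmod y)\<^sup>2)"
      using r1 by (intro mult_left_mono) auto
    moreover have "(1 - r) * \<bar>Re (\<tau> * cnj y)\<bar> \<le> (1 - r) * (cmod y)\<^sup>2"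
      using r1 abs_Re_tau[OF y] by (intro mult_left_mono) auto
    ultimately have "\<bar>Re ((of_nat k + \<tau>\<^sup>2) / \<tau> * cnj y)\<bar> \<le> (1 - r / 4) * (cmod y)\<^sup>2"
      using le by (simp add: algebra_simps)
    also have "\<dots> \<le> (1 - 1 / (8 * q)) * (cmod y)\<^sup>2"
      using r q8 by (intro mult_right_mono) auto
    finally show ?thesis .
  qed
qed

lemma odd_reflect:
  assumes "0 < w" "\<not> Ztau_dvd \<tau> \<tau> E"
  shows "\<not> Ztau_dvd \<tau> \<tau> (\<tau> ^ w - E)"
  using tau_dvd_diff[OF tau_dvd_power[OF assms(1)], of "\<tau> ^ w - E"] assms(2) by auto

text \<open>The reflection of \<open>E\<close> to \<open>\<tau> ^ w - E\<close> changes the sign of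
  \<open>m\<close>, and \<open>u\<close> may be negated as well, so only absolute values of the
  projections matter.\<close>

lemma not_optimal_half_lattice:
  assumes D: "min_norm_digit_set \<tau> w D" and w: "3 \<le> w"
    and large: "64 * (real q)\<^sup>2 \<le> cmod (\<tau> ^ w)" and u: "good_shift u"
    and E: "E \<in> Ztau \<tau>" "\<not> Ztau_dvd \<tau> \<tau> E" "2 * E = \<tau> ^ w + m"
    and m: "Re (m * cnj (\<tau> ^ w)) \<noteq> 0"
      "\<bar>Re (m * cnj (\<tau> ^ w))\<bar> / 2 < \<bar>Re (u / \<tau> * cnj (\<tau> ^ w))\<bar>"
      "cmod m \<le> cmod (\<tau> ^ w) / (8 * sqrt q)"
  shows "\<not> wNAF_optimal \<tau> w D"
proof -
  define u' where "u' = (if 0 < Re (u / \<tau> * cnj (\<tau> ^ w)) then u else - u)"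
  have u': "good_shift u'" using u good_shift_uminus by (simp add: u'_def)
  have Re_u': "Re (u' / \<tau> * cnj (\<tau> ^ w)) = \<bar>Re (u / \<tau> * cnj (\<tau> ^ w))\<bar>"
    by (auto simp: u'_def)
  define E' where "E' = (if 0 < Re (m * cnj (\<tau> ^ w)) then E else \<tau> ^ w - E)"
  have E': "E' \<in> Ztau \<tau>" "\<not> Ztau_dvd \<tau> \<tau> E'"
    using E(1,2) odd_reflect[of w E] w by (auto simp: E'_def)
  define F where "F = E' - \<tau> ^ w / 2"
  have E_eq: "E = (\<tau> ^ w + m) / 2" using E(3) by (metis nonzero_mult_div_cancel_left zero_neq_numeral)
  have F_eq: "F = (if 0 < Re (m * cnj (\<tau> ^ w)) then m / 2 else - m / 2)"
    unfolding F_def E'_def E_eq by (auto simp: field_simps)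
  have Re_F: "Re (F * cnj (\<tau> ^ w)) = \<bar>Re (m * cnj (\<tau> ^ w))\<bar> / 2"
    unfolding F_eq by (auto simp: field_simps)
  have "cmod F = cmod m / 2" unfolding F_eq by (auto simp: norm_divide)
  then show ?thesis
    using m by (intro not_optimal_beyond_edge[OF D w large u' E', of F])
      (simp_all only: Re_F Re_u', auto simp: F_def)
qed

subsection \<open>Powers of the base\<close>

fun lucas_U :: "nat \<Rightarrow> int" where
  "lucas_U 0 = 0"
| "lucas_U (Suc 0) = 1"
| "lucas_U (Suc (Suc n)) = p * lucas_U (Suc n) - int q * lucas_U n"

lemma tau_power_Suc: "\<tau> ^ Suc n = of_int (- int q * lucas_U n) + of_int (lucas_U (Suc n)) * \<tau>"
proof (induction n)
  case (Suc n)
  have "\<tau> ^ Suc (Suc n) = \<tau> * (of_int (- int q * lucas_U n) + of_int (lucas_U (Suc n)) * \<tau>)"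
    using Suc by simp
  also have "\<dots> = of_int (- int q * lucas_U (Suc n)) + of_int (lucas_U (Suc (Suc n))) * \<tau>"
    unfolding tau_times by (simp add: algebra_simps)
  finally show ?case .
qed simp

text \<open>Modulo any divisor of \<open>q\<close> the recursion is multiplication by the unit
  \<open>p\<close>.\<close>

lemma coprime_lucas_U: "coprime (lucas_U (Suc n)) (int q)"
proof (induction n)
  case (Suc n)
  show ?case
  proof (rule coprimeI)
    fix c assume c: "c dvd lucas_U (Suc (Suc n))" "c dvd int q"
    then have "c dvd (p * lucas_U (Suc n) - int q * lucas_U n) + int q * lucas_U n"
      by (intro dvd_add dvd_mult2) simp_all
    then have "c dvd lucas_U (Suc n)" using p_unit by auto
    with c(2) Suc show "is_unit c" by (meson coprime_common_divisor)
  qed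
qed simp

text \<open>The trace is congruent to \<open>p * lucas_U n\<close> modulo \<open>q\<close>, so
  coprimality is inherited.\<close>

lemma trace_power:
  assumes "0 < n"
  obtains v :: int where "\<tau> ^ n + cnj (\<tau> ^ n) = of_int v" "coprime v (int q)"
proof -
  obtain m where m: "n = Suc m" using assms by (cases n) auto
  let ?v = "p * lucas_U n - 2 * int q * lucas_U m"
  have "\<tau> ^ n + cnj (\<tau> ^ n) = of_int ?v"
    unfolding m tau_power_Suc by (simp add: cnj_tau algebra_simps)
  moreover have "coprime ?v (int q)"
  proof (rule coprimeI)
    fix c assume c: "c dvd ?v" "c dvd int q"
    then have "c dvd ?v + int q * (2 * lucas_U m)" by (intro dvd_add dvd_mult2) simp_all
    then have "c dvd p * lucas_U n" by (simp add: algebra_simps)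
    then have "c dvd lucas_U n" using p_unit by auto
    with c(2) coprime_lucas_U[of m] show "is_unit c" unfolding m by (meson coprime_common_divisor)
  qed
  ultimately show ?thesis by (rule that)
qed

lemma coprime_q_nz:
  assumes "coprime v (int q)"
  shows "v \<noteq> 0"
  using assms q_ge_2 by auto

text \<open>
  If \<open>m\<close> is orthogonal to \<open>T = \<tau> ^ w\<close>, then \<open>T\<close> divides \<open>m * (T + cnj T)\<close>, where the trace
  \<open>T + cnj T\<close> is prime to \<open>q\<close>; comparing norms forces \<open>m = 0\<close> or \<open>cmod T \<le> cmod m\<close>.
\<close>

lemma Re_nonzero_of_small:
  assumes m: "m \<in> Ztau \<tau>" "m \<noteq> 0" "cmod m < cmod (\<tau> ^ w)" and w: "0 < w"
  shows "Re (m * cnj (\<tau> ^ w)) \<noteq> 0"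
proof
  assume zero: "Re (m * cnj (\<tau> ^ w)) = 0"
  define T where "T = \<tau> ^ w"
  obtain v where v: "T + cnj T = of_int v" "coprime v (int q)"
    unfolding T_def using w by (rule trace_power)
  obtain a b where ab: "m = of_int a + of_int b * \<tau>" using m(1) by (rule Ztau_cases)
  define n where "n = a\<^sup>2 + p * a * b + int q * b\<^sup>2"
  have n: "(cmod m)\<^sup>2 = n" unfolding ab n_def by (rule cmod_sq_Ztau)
  have "m * cnj T + cnj (m * cnj T) = 0"
    using zero unfolding T_def by (simp only: complex_add_cnj) simp
  then have "m * of_int v = T * (m - cnj m)"
    unfolding v(1)[symmetric] by (simp add: algebra_simps add_eq_0_iff)
  also have "m - cnj m = of_int b * (\<tau> - cnj \<tau>)" by (simp add: ab algebra_simps)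
  finally have "cmod (m * of_int v) = cmod (T * (of_int b * (\<tau> - cnj \<tau>)))" by simp
  then have "(cmod m)\<^sup>2 * (real_of_int v)\<^sup>2 = (cmod T)\<^sup>2 * ((real_of_int b)\<^sup>2 * (cmod (\<tau> - cnj \<tau>))\<^sup>2)"
    by (metis norm_mult norm_of_int power_mult_distrib power2_abs)
  moreover have "(cmod (\<tau> - cnj \<tau>))\<^sup>2 = 4 * real q - 1"
    unfolding cmod_power2 using Im_tau_sq by (simp add: power2_eq_square)
  ultimately have "real_of_int (n * v\<^sup>2) = real_of_int (int q ^ w * (b\<^sup>2 * (4 * int q - 1)))"
    by (simp add: n T_def cmod_tau_power_sq)
  then have "n * v\<^sup>2 = int q ^ w * (b\<^sup>2 * (4 * int q - 1))" by (simp only: of_int_eq_iff)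
  then have "int q ^ w dvd n * v\<^sup>2" by simp
  moreover have "coprime (int q ^ w) (v\<^sup>2)" using v(2) by (simp add: coprime_commute)
  ultimately have "int q ^ w dvd n" by (simp add: coprime_dvd_mult_left_iff)
  moreover have "0 < real_of_int n" using m(2) unfolding n[symmetric] by simp
  ultimately have "int q ^ w \<le> n" by (intro zdvd_imp_le) simp_all
  then have "real_of_int (int q ^ w) \<le> real_of_int n" by (simp only: of_int_le_iff)
  then have "(cmod T)\<^sup>2 \<le> (cmod m)\<^sup>2"
    unfolding n by (simp add: T_def cmod_tau_power_sq)
  with m(3) show False by (simp add: T_def)
qed

text \<open>
  With \<open>v\<close> the trace of \<open>\<tau> ^ k\<close>, the trace of \<open>\<tau> ^ (3 * k)\<close> is \<open>v * (v\<^sup>2 - 3 * q ^ k)\<close>; its two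
  nonzero factors cannot both be small.
\<close>

lemma trace_power_3_large:
  assumes "0 < k" "1 \<le> M" "M\<^sup>2 \<le> real q ^ k"
  shows "M \<le> 2 * \<bar>Re (\<tau> ^ (3 * k))\<bar>"
proof -
  obtain v where v: "\<tau> ^ k + cnj (\<tau> ^ k) = of_int v" "coprime v (int q)"
    using assms(1) by (rule trace_power)
  define x where "x = \<tau> ^ k"
  define W where "W = v\<^sup>2 - 3 * int q ^ k"
  have v': "x + cnj x = of_int v" using v(1) by (simp add: x_def)
  have norm: "x * cnj x = of_nat q ^ k"
    by (simp add: x_def tau_cnj flip: power_mult_distrib)
  have "x ^ 3 + cnj x ^ 3 = (x + cnj x) * ((x + cnj x)\<^sup>2 - 3 * (x * cnj x))"
    by (simp add: power2_eq_square power3_eq_cube algebra_simps)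
  also have "\<dots> = of_int (v * W)" by (simp add: v' norm W_def)
  also have "x ^ 3 + cnj x ^ 3 = of_real (2 * Re (\<tau> ^ (3 * k)))"
    by (simp add: x_def complex_add_cnj mult.commute flip: power_mult complex_cnj_power)
  finally have "complex_of_real (2 * Re (\<tau> ^ (3 * k))) = complex_of_real (of_int (v * W))" by simp
  then have tr: "2 * Re (\<tau> ^ (3 * k)) = of_int (v * W)" by (simp only: of_real_eq_iff)
  have "v \<noteq> 0" using v(2) by (rule coprime_q_nz)
  then have v1: "1 \<le> \<bar>real_of_int v\<bar>" by linarith
  have "W \<noteq> 0"
  proof
    assume "W = 0"
    then have "int q dvd v\<^sup>2" using assms(1) by (simp add: W_def)
    moreover have "coprime (v\<^sup>2) (int q)" using v(2) by simp
    ultimately have "is_unit (int q)" by (metis coprime_common_divisor dvd_refl)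
    then show False using q_ge_2 by simp
  qed
  then have W1: "1 \<le> \<bar>real_of_int W\<bar>" by linarith
  have "M \<le> \<bar>real_of_int v\<bar> * \<bar>real_of_int W\<bar>"
  proof (cases "M \<le> \<bar>real_of_int v\<bar>")
    case True
    then have "M * 1 \<le> \<bar>real_of_int v\<bar> * \<bar>real_of_int W\<bar>" using W1 assms by (intro mult_mono) auto
    then show ?thesis by simp
  next
    case False
    then have "\<bar>real_of_int v\<bar>\<^sup>2 \<le> M\<^sup>2" by (intro power_mono) auto
    then have "(real_of_int v)\<^sup>2 \<le> real q ^ k" using assms(3) by simp
    \<comment> \<open>A small \<open>v\<close> leaves \<open>W\<close> at most
      \<open>-2 * q ^ k\<close>.\<close>
    then have "2 * real q ^ k \<le> \<bar>real_of_int W\<bar>" by (simp add: W_def)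
    moreover have "M ^ 1 \<le> M\<^sup>2" using assms(2) by (intro power_increasing) auto
    ultimately have "M \<le> \<bar>real_of_int W\<bar>" using assms by simp
    then have "1 * M \<le> \<bar>real_of_int v\<bar> * \<bar>real_of_int W\<bar>" using v1 assms by (intro mult_mono) auto
    then show ?thesis by simp
  qed
  then have "M \<le> \<bar>of_int (v * W)\<bar>" by (simp add: abs_mult)
  then show ?thesis unfolding tr[symmetric] by simp
qed

text \<open>For odd \<open>q\<close> the recursion modulo 2 is that of the Fibonacci numbers, with
  period 0, 1, 1.\<close>

lemma even_lucas_U_iff:
  assumes "odd q"
  shows "even (lucas_U n) \<longleftrightarrow> 3 dvd n"
proof (induction n rule: less_induct)
  case (less n)
  show ?case
  proof (cases "n < 3")
    case True
    then have "n = 0 \<or> n = 1 \<or> n = 2" by linarith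
    then show ?thesis using odd_p by (auto simp: numeral_2_eq_2) presburger+
  next
    case False
    define m where "m = n - 3"
    then have n: "n = Suc (Suc (Suc m))" using False by simp
    have "even (lucas_U n) \<longleftrightarrow> even (lucas_U m)" using assms odd_p unfolding n by auto
    moreover have "3 dvd n \<longleftrightarrow> 3 dvd m" using n by presburger
    ultimately show ?thesis using less[of m] n by simp
  qed
qed

lemma odd_lucas_U:
  assumes "even q"
  shows "odd (lucas_U (Suc n))"
  using coprime_lucas_U[of n] assms by (meson coprime_common_divisor even_of_nat odd_one)

text \<open>As \<open>a\<close> runs over the odd integers, the points \<open>2 * x + a * z\<close>
  have spacing \<open>2 * \<bar>z\<bar>\<close>, so one of them is within
  \<open>\<bar>z\<bar>\<close> of 0.\<close>

lemma odd_nearest: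
  fixes x z :: real
  assumes "z \<noteq> 0"
  obtains a :: int where "odd a" "\<bar>2 * x + a * z\<bar> \<le> \<bar>z\<bar>" "\<bar>a\<bar> * \<bar>z\<bar> \<le> \<bar>z\<bar> + 2 * \<bar>x\<bar>"
proof -
  define n where "n = round (- (2 * x + z) / (2 * z))"
  define a where "a = 2 * n + 1"
  have "\<bar>n - (- (2 * x + z) / (2 * z))\<bar> \<le> 1 / 2"
    unfolding n_def using of_int_round_abs_le by simp
  then have "\<bar>n - (- (2 * x + z) / (2 * z))\<bar> * \<bar>2 * z\<bar> \<le> 1 / 2 * \<bar>2 * z\<bar>"
    by (intro mult_right_mono) auto
  also have "\<bar>n - (- (2 * x + z) / (2 * z))\<bar> * \<bar>2 * z\<bar> = \<bar>2 * x + a * z\<bar>"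
    using assms by (simp add: a_def field_simps flip: abs_mult)
  finally have *: "\<bar>2 * x + a * z\<bar> \<le> \<bar>z\<bar>" by (simp add: abs_mult)
  then have "\<bar>a * z\<bar> \<le> \<bar>z\<bar> + 2 * \<bar>x\<bar>" by linarith
  then show ?thesis using * by (intro that[of a]) (auto simp: a_def abs_mult)
qed

subsection \<open>Choice of the half-lattice vector\<close>

text \<open>The 12 comes from \<open>64 ^ 2 = 2 ^ 12\<close>, which is at most
  \<open>q ^ 12\<close>.\<close>

lemma power_q_ge:
  assumes "2 * i + 12 \<le> n"
  shows "(64 * real q ^ i)\<^sup>2 \<le> real q ^ n"
proof -
  have "(64 * real q ^ i)\<^sup>2 = 2 ^ 12 * real q ^ (2 * i)"
    by (simp add: power_mult_distrib power_mult mult.commute[of 2 i])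
  also have "\<dots> \<le> real q ^ 12 * real q ^ (2 * i)"
    using real_q_ge_2 by (intro mult_right_mono power_mono) auto
  also have "\<dots> = real q ^ (2 * i + 12)" by (simp add: power_add)
  also have "\<dots> \<le> real q ^ n" using assms real_q_ge_2 by (intro power_increasing) auto
  finally show ?thesis .
qed

lemma tau_power_large:
  assumes "16 \<le> w"
  shows "64 * (real q)\<^sup>2 \<le> cmod (\<tau> ^ w)"
proof -
  have "(64 * (real q)\<^sup>2)\<^sup>2 \<le> (cmod (\<tau> ^ w))\<^sup>2"
    unfolding cmod_tau_power_sq using power_q_ge[of 2 w] assms by simp
  then show ?thesis by (rule power2_le_imp_le) simp
qed

lemma sqrt_q_large:
  assumes "16 \<le> w"
  shows "64 * sqrt q \<le> cmod (\<tau> ^ w) / sqrt q" and "64 * (q * sqrt q) \<le> cmod (\<tau> ^ w)"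
proof -
  have "64 * (real q * sqrt q) \<le> 64 * (real q * real q)"
    using sqrt_q by (intro mult_left_mono) auto
  with tau_power_large[OF assms] show *: "64 * (q * sqrt q) \<le> cmod (\<tau> ^ w)"
    by (simp add: power2_eq_square)
  have "real q * 1 \<le> real q * sqrt q" using sqrt_q by (intro mult_left_mono) auto
  with * have "64 * (sqrt q * sqrt q) \<le> cmod (\<tau> ^ w)" unfolding sqrt_q(3) by linarith
  moreover define r where "r = sqrt q"
  ultimately have "64 * (r * r) \<le> cmod (\<tau> ^ w)" "1 \<le> r" using sqrt_q(1) by (simp_all only:)
  then have "64 * r \<le> cmod (\<tau> ^ w) / r" by (simp add: le_divide_eq mult_ac)
  then show "64 * sqrt q \<le> cmod (\<tau> ^ w) / sqrt q" by (simp add: r_def)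
qed

text \<open>This is \<open>q / 2\<close> rounded up, the least value to which both
  \<open>good_shiftI_int\<close> and \<open>good_shiftI_tau_sq\<close> apply.\<close>

definition k\<^sub>0 :: nat where "k\<^sub>0 = q - q div 2"

lemma k0: "0 < k\<^sub>0" "k\<^sub>0 < q" "q \<le> 2 * k\<^sub>0" "odd q \<Longrightarrow> q < 2 * k\<^sub>0"
  using q_ge_2 by (auto simp: k\<^sub>0_def elim: oddE)

lemma k0_div_tau: "of_nat k\<^sub>0 / \<tau> = of_real (k\<^sub>0 / q) * cnj \<tau>"
  using tau_nz tau_cnj q_ge_2 by (simp add: field_simps)

text \<open>The carries used are \<open>k\<^sub>0\<close> and
  \<open>k\<^sub>0 + \<tau>\<^sup>2\<close>. That \<open>m\<close> has nonzero projection comes for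
  free from \<open>Re_nonzero_of_small\<close>.\<close>

lemma not_optimal_two_shifts:
  assumes D: "min_norm_digit_set \<tau> w D" and w: "16 \<le> w"
    and E: "E \<in> Ztau \<tau>" "\<not> Ztau_dvd \<tau> \<tau> E" "2 * E = \<tau> ^ w + m"
    and m: "m \<in> Ztau \<tau>" "m \<noteq> 0" "cmod m \<le> cmod (\<tau> ^ w) / (8 * sqrt q)"
    and shift: "\<bar>Re (m * cnj (\<tau> ^ w))\<bar> / 2 < \<bar>Re (of_nat k\<^sub>0 / \<tau> * cnj (\<tau> ^ w))\<bar> \<or>
      \<bar>Re (m * cnj (\<tau> ^ w))\<bar> / 2 < \<bar>Re ((of_nat k\<^sub>0 / \<tau> + \<tau>) * cnj (\<tau> ^ w))\<bar>"
  shows "\<not> wNAF_optimal \<tau> w D"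
proof -
  have "cmod (\<tau> ^ w) * 1 < cmod (\<tau> ^ w) * (8 * sqrt q)"
    using tau_nz sqrt_q(1) by (intro mult_strict_left_mono) (linarith, simp)
  then have "cmod (\<tau> ^ w) / (8 * sqrt q) < cmod (\<tau> ^ w)"
    using sqrt_q(1) by (subst pos_divide_less_eq) auto
  with m(3) have "cmod m < cmod (\<tau> ^ w)" by linarith
  with m w have nz: "Re (m * cnj (\<tau> ^ w)) \<noteq> 0" by (intro Re_nonzero_of_small) auto
  have tau2: "(of_nat k\<^sub>0 + \<tau>\<^sup>2) / \<tau> = of_nat k\<^sub>0 / \<tau> + \<tau>"
    using tau_nz by (simp add: field_simps power2_eq_square)
  note * = not_optimal_half_lattice[OF D _ tau_power_large[OF w] _ E nz _ m(3)]
  from shift show ?thesis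
  proof
    assume "\<bar>Re (m * cnj (\<tau> ^ w))\<bar> / 2 < \<bar>Re (of_nat k\<^sub>0 / \<tau> * cnj (\<tau> ^ w))\<bar>"
    with w k0 show ?thesis by (intro *[OF _ good_shiftI_int]) auto
  next
    assume h: "\<bar>Re (m * cnj (\<tau> ^ w))\<bar> / 2 < \<bar>Re ((of_nat k\<^sub>0 / \<tau> + \<tau>) * cnj (\<tau> ^ w))\<bar>"
    show ?thesis
      by (rule *[OF _ good_shiftI_tau_sq[OF k0(2,3)]]) (use w in simp, unfold tau2, rule h)
  qed
qed

text \<open>
  The two available shifts differ by \<open>\<tau>\<close>, so one of them projects to at least half the
  projection of \<open>\<tau>\<close>.
\<close>

lemma not_optimal_if_le_tau:
  assumes D: "min_norm_digit_set \<tau> w D" and w: "16 \<le> w"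
    and E: "E \<in> Ztau \<tau>" "\<not> Ztau_dvd \<tau> \<tau> E" "2 * E = \<tau> ^ w + m"
    and m: "m \<in> Ztau \<tau>" "m \<noteq> 0" "cmod m \<le> cmod (\<tau> ^ w) / (8 * sqrt q)"
    and le: "\<bar>Re (m * cnj (\<tau> ^ w))\<bar> \<le> \<bar>Re (\<tau> * cnj (\<tau> ^ w))\<bar>"
  shows "\<not> wNAF_optimal \<tau> w D"
proof (rule not_optimal_two_shifts[OF D w E m], rule ccontr)
  define P where "P = Re (of_nat k\<^sub>0 / \<tau> * cnj (\<tau> ^ w))"
  define Z where "Z = Re (\<tau> * cnj (\<tau> ^ w))"
  have PZ: "Re ((of_nat k\<^sub>0 / \<tau> + \<tau>) * cnj (\<tau> ^ w)) = P + Z"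
    unfolding P_def Z_def by (simp only: distrib_right plus_complex.sel)
  assume "\<not> (\<bar>Re (m * cnj (\<tau> ^ w))\<bar> / 2 < \<bar>Re (of_nat k\<^sub>0 / \<tau> * cnj (\<tau> ^ w))\<bar> \<or>
      \<bar>Re (m * cnj (\<tau> ^ w))\<bar> / 2 < \<bar>Re ((of_nat k\<^sub>0 / \<tau> + \<tau>) * cnj (\<tau> ^ w))\<bar>)"
  then have "\<bar>P\<bar> \<le> \<bar>Z\<bar> / 2" "\<bar>P + Z\<bar> \<le> \<bar>Z\<bar> / 2"
    using le unfolding PZ unfolding P_def[symmetric] Z_def[symmetric] by linarith+
  then have zero: "2 * P + Z = 0" by linarith
  \<comment> \<open>If both shifts fail, \<open>2 * k\<^sub>0 / \<tau> + \<tau>\<close> is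
    orthogonal to \<open>\<tau> ^ w\<close>. Scaling by \<open>q\<close> brings it into the ring as
    a nonzero element too short for that.\<close>
  define n where "n = of_int (2 * int k\<^sub>0 * p) + of_int (int q - 2 * int k\<^sub>0) * \<tau>"
  have n_eq: "n = of_nat q * (2 * (of_nat k\<^sub>0 / \<tau>) + \<tau>)"
  proof -
    have k: "of_nat q * (of_nat k\<^sub>0 / \<tau>) = of_nat k\<^sub>0 * cnj \<tau>"
      unfolding k0_div_tau using q_ge_2 by simp
    have "of_nat q * (2 * x + \<tau>) = 2 * (of_nat q * x) + of_nat q * \<tau>" for x
      by (simp add: algebra_simps)
    then show ?thesis unfolding n_def by (simp only: k) (simp add: cnj_tau algebra_simps)
  qed
  have "Re (n * cnj (\<tau> ^ w)) = q * (2 * P + Z)"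
  proof -
    have "n * cnj (\<tau> ^ w) = of_nat q * (2 * (of_nat k\<^sub>0 / \<tau> * cnj (\<tau> ^ w)) + \<tau> * cnj (\<tau> ^ w))"
      unfolding n_eq by (simp only: distrib_right mult.assoc)
    moreover have "Re (of_nat q * (2 * x + y)) = q * (2 * Re x + Re y)" for x y by simp
    ultimately show ?thesis unfolding P_def Z_def by (simp only:)
  qed
  moreover have "Re (n * cnj (\<tau> ^ w)) \<noteq> 0"
  proof (rule Re_nonzero_of_small)
    show "n \<in> Ztau \<tau>" unfolding n_def by (rule in_Ztau)
    have "2 * int k\<^sub>0 * p \<noteq> 0" using k0(1) p_unit by auto
    then show "n \<noteq> 0" unfolding n_def Ztau_eq_0_iff by blast
    have "cmod n \<le> q * (2 * (k\<^sub>0 / q * sqrt q) + sqrt q)"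
    proof -
      have "cmod (2 * x + \<tau>) \<le> 2 * cmod x + cmod \<tau>" for x
        using norm_triangle_ineq[of "2 * x" \<tau>] by (simp add: norm_mult)
      from this[of "of_nat k\<^sub>0 / \<tau>"]
      have "cmod (2 * (of_nat k\<^sub>0 / \<tau>) + \<tau>) \<le> 2 * cmod (of_nat k\<^sub>0 / \<tau>) + cmod \<tau>" .
      also have "cmod (of_nat k\<^sub>0 / \<tau>) = k\<^sub>0 / q * sqrt q"
        unfolding k0_div_tau norm_mult norm_of_real by (simp add: cmod_tau)
      finally have "cmod (2 * (of_nat k\<^sub>0 / \<tau>) + \<tau>) \<le> 2 * (k\<^sub>0 / q * sqrt q) + sqrt q"
        unfolding cmod_tau .
      then show ?thesis unfolding n_eq norm_mult norm_of_nat by (intro mult_left_mono) auto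
    qed
    also have "\<dots> \<le> q * (2 * (1 * sqrt q) + sqrt q)"
      using k0(2) by (intro mult_left_mono add_right_mono mult_right_mono) auto
    also have "\<dots> < 64 * (q * sqrt q)" using q_ge_2 by simp
    also have "\<dots> \<le> cmod (\<tau> ^ w)" by (rule sqrt_q_large(2)[OF w])
    finally show "cmod n < cmod (\<tau> ^ w)" .
  qed (use w in simp)
  ultimately show False using zero by simp
qed

text \<open>By \<open>tau_power_Suc\<close> the parity conditions say that \<open>\<tau> ^ w\<close>
  and \<open>m\<close> agree modulo 2; the last condition tests the constant coordinate of
  \<open>E\<close> through \<open>tau_dvd_iff\<close>.\<close>

lemma half_sum:
  assumes "0 < w" "even (a - int q * lucas_U (w - 1))" "even (b + lucas_U w)"
    and "\<not> int q dvd (a - int q * lucas_U (w - 1)) div 2"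
  obtains E where "E \<in> Ztau \<tau>" "\<not> Ztau_dvd \<tau> \<tau> E" "2 * E = \<tau> ^ w + (of_int a + of_int b * \<tau>)"
proof -
  define c where "c = (a - int q * lucas_U (w - 1)) div 2"
  define d where "d = (b + lucas_U w) div 2"
  have c: "2 * c = a - int q * lucas_U (w - 1)" and d: "2 * d = b + lucas_U w"
    using assms by (simp_all add: c_def d_def)
  have "Suc (w - 1) = w" using assms(1) by simp
  then have "\<tau> ^ w + (of_int a + of_int b * \<tau>)
      = of_int (a - int q * lucas_U (w - 1)) + of_int (b + lucas_U w) * \<tau>"
    using tau_power_Suc[of "w - 1"] by (simp add: algebra_simps)
  also have "\<dots> = 2 * (of_int c + of_int d * \<tau>)"
    unfolding c[symmetric] d[symmetric] by (simp add: algebra_simps)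
  finally show ?thesis
    using that[of "of_int c + of_int d * \<tau>"] assms(4) by (simp add: tau_dvd_iff c_def)
qed

lemma small_bound:
  assumes "16 \<le> w" "cmod m \<le> sqrt q"
  shows "cmod m \<le> cmod (\<tau> ^ w) / (8 * sqrt q)"
proof -
  have "8 * cmod m \<le> cmod (\<tau> ^ w) / sqrt q"
    using sqrt_q_large(1)[OF assms(1)] assms(2) sqrt_q(1) by linarith
  then show ?thesis by simp
qed

section \<open>Even and odd \<open>q\<close>\<close>

lemma not_optimal_even:
  assumes D: "min_norm_digit_set \<tau> w D" and w: "16 \<le> w" and q: "even q"
  shows "\<not> wNAF_optimal \<tau> w D"
proof -
  define v where "v = w - 2"
  then have v: "w = Suc (Suc v)" using w by simp
  obtain h where h: "q = 2 * h" using q by (elim evenE)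
  have odd: "odd (lucas_U w)" "odd (lucas_U (w - 1))"
    using odd_lucas_U[OF q, of "Suc v"] odd_lucas_U[OF q, of v] unfolding v
    by (simp_all del: lucas_U.simps)
  \<comment> \<open>For even \<open>q\<close>, \<open>\<tau> ^ w\<close> agrees with
    \<open>\<tau>\<close> modulo 2, so \<open>m = \<tau>\<close> is used. This is the constant
    coordinate of \<open>E\<close>; it is an odd multiple of \<open>q / 2\<close>.\<close>
  have "\<not> int q dvd - (int h * lucas_U (w - 1))"
  proof
    assume "int q dvd - (int h * lucas_U (w - 1))"
    then have "int h * 2 dvd int h * lucas_U (w - 1)" using h by (simp add: mult.commute)
    then have "even (lucas_U (w - 1))" using h q_ge_2 by (subst (asm) dvd_mult_cancel_left) auto
    with odd show False by simp
  qed
  moreover have "(0 - int q * x) div 2 = - (int h * x)" for x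
  proof -
    have "0 - int q * x = 2 * (- (int h * x))" using h by simp
    then show ?thesis by (simp only: nonzero_mult_div_cancel_left zero_neq_numeral not_False_eq_True)
  qed
  ultimately have "\<not> int q dvd (0 - int q * lucas_U (w - 1)) div 2" by (simp only:) simp
  then obtain E where E: "E \<in> Ztau \<tau>" "\<not> Ztau_dvd \<tau> \<tau> E" "2 * E = \<tau> ^ w + (of_int 0 + of_int 1 * \<tau>)"
    by (rule half_sum[of w 0 1, rotated 3]) (use w odd q in simp_all)
  show ?thesis
    by (rule not_optimal_if_le_tau[OF D w E(1,2), of \<tau>])
      (use E(3) tau_nz small_bound[OF w, of \<tau>] cmod_tau in auto)
qed

lemma odd_q_dvd_half:
  assumes "odd q" "even (a - int q * x)" "int q dvd (a - int q * x) div 2"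
  shows "int q dvd a"
proof -
  have "a = 2 * ((a - int q * x) div 2) + int q * x" using assms(2) by simp
  then show ?thesis using assms(3) by (metis dvd_add dvd_mult dvd_triv_left)
qed

text \<open>The cases are the classes of \<open>\<tau> ^ w\<close> modulo 2, read from two
  consecutive Lucas numbers, which are never both even. They use \<open>m = cnj \<tau>\<close>,
  \<open>m = 1\<close> and \<open>m = 2 * cnj \<tau> + a * \<tau>\<close> respectively.\<close>

lemma not_optimal_odd:
  assumes D: "min_norm_digit_set \<tau> w D" and w: "100 \<le> w" and q: "odd q"
  shows "\<not> wNAF_optimal \<tau> w D"
proof -
  have w16: "16 \<le> w" and w0: "0 < w" using w by simp_all
  define T where "T = \<tau> ^ w"
  define Y where "Y = Re (cnj \<tau> * cnj T)"
  have qp: "\<not> int q dvd p" "\<not> int q dvd 1" "\<not> int q dvd 2 * p"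
  proof -
    have "q \<noteq> 2" using q by auto
    then have "3 \<le> q" using q_ge_2 by simp
    then have "\<not> int q dvd 1" "\<not> int q dvd 2"
      using zdvd_imp_le[of "int q" 1] zdvd_imp_le[of "int q" 2] by linarith+
    then show "\<not> int q dvd p" "\<not> int q dvd 1" "\<not> int q dvd 2 * p"
      using p_unit by auto
  qed
  define r where "r = k\<^sub>0 / q"
  have r: "1 / 2 < r" "r < 1"
    using k0(2) k0(4)[OF q] q_ge_2 unfolding r_def by (simp_all add: field_simps)
  have P: "Re (of_nat k\<^sub>0 / \<tau> * cnj T) = r * Y"
  proof -
    have "Re (of_real c * z) = c * Re z" for c z by simp
    then show ?thesis unfolding k0_div_tau mult.assoc r_def Y_def .
  qed
  have Y: "Y \<noteq> 0" unfolding Y_def T_def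
  proof (rule Re_nonzero_of_small)
    have "64 * (1 * sqrt q) \<le> 64 * (q * sqrt q)"
      using q_ge_2 by (intro mult_left_mono mult_right_mono) auto
    with sqrt_q_large(2)[OF w16] sqrt_q(1) show "cmod (cnj \<tau>) < cmod (\<tau> ^ w)"
      unfolding complex_mod_cnj cmod_tau by linarith
  qed (use Ztau_cnj tau_nz w0 in auto)
  have par: "\<not> (even (lucas_U (w - 1)) \<and> even (lucas_U w))"
    unfolding even_lucas_U_iff[OF q] using w0 by presburger
  consider "odd (lucas_U (w - 1))" "odd (lucas_U w)" | "odd (lucas_U (w - 1))" "even (lucas_U w)"
    | "even (lucas_U (w - 1))" "odd (lucas_U w)"
    using par by blast
  then show ?thesis
  proof cases
    case 1
    have ev: "even (p - int q * lucas_U (w - 1))" using 1 q odd_p by simp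
    then obtain E where E: "E \<in> Ztau \<tau>" "\<not> Ztau_dvd \<tau> \<tau> E"
        "2 * E = \<tau> ^ w + (of_int p + of_int (-1) * \<tau>)"
      using half_sum[of w p "-1"] w0 1 odd_q_dvd_half[OF q ev] qp by auto
    have m: "of_int p + of_int (-1) * \<tau> = cnj \<tau>" by (simp add: cnj_tau)
    \<comment> \<open>The shift \<open>k\<^sub>0 / \<tau>\<close> is \<open>r * cnj \<tau>\<close>
      with \<open>r > 1 / 2\<close>, and \<open>m / 2\<close> is half of
      \<open>cnj \<tau>\<close>.\<close>
    have "\<bar>Re (cnj \<tau> * cnj T)\<bar> / 2 < \<bar>Re (of_nat k\<^sub>0 / \<tau> * cnj T)\<bar>"
      unfolding P Y_def[symmetric] using r Y by (simp add: abs_mult)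
    then show ?thesis
      using E(3) tau_nz small_bound[OF w16, of "cnj \<tau>"] cmod_tau Ztau_cnj unfolding m T_def
      by (intro not_optimal_two_shifts[OF D w16 E(1,2), of "cnj \<tau>"]) auto
  next
    case 2
    have ev: "even (1 - int q * lucas_U (w - 1))" using 2 q by simp
    then obtain E where E: "E \<in> Ztau \<tau>" "\<not> Ztau_dvd \<tau> \<tau> E"
        "2 * E = \<tau> ^ w + (of_int 1 + of_int 0 * \<tau>)"
      using half_sum[of w 1 0] w0 2 odd_q_dvd_half[OF q ev] qp by auto
    define X where "X = Re (1 * cnj T)"
    have Q: "Re ((of_nat k\<^sub>0 / \<tau> + \<tau>) * cnj T) = p * X - (1 - r) * Y"
    proof -
      have "(of_nat k\<^sub>0 / \<tau> + \<tau>) * cnj T = of_int p * cnj T - of_real (1 - r) * (cnj \<tau> * cnj T)"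
        unfolding k0_div_tau r_def[symmetric] cnj_tau by (simp add: algebra_simps)
      moreover have "Re (of_int p * x - of_real (1 - r) * y) = p * Re x - (1 - r) * Re y" for x y
        by simp
      ultimately show ?thesis unfolding X_def Y_def by simp
    qed
    \<comment> \<open>If both failed, \<open>\<bar>X\<bar> / 2\<close> would be at most
      \<open>(1 - r) * \<bar>Y\<bar>\<close> and at least the larger
      \<open>r * \<bar>Y\<bar>\<close>.\<close>
    have "\<bar>X\<bar> / 2 < \<bar>r * Y\<bar> \<or> \<bar>X\<bar> / 2 < \<bar>p * X - (1 - r) * Y\<bar>"
    proof (rule ccontr)
      assume "\<not> ?thesis"
      then have le: "r * \<bar>Y\<bar> \<le> \<bar>X\<bar> / 2" "\<bar>p * X - (1 - r) * Y\<bar> \<le> \<bar>X\<bar> / 2"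
        using r by (auto simp: abs_mult)
      have "\<bar>p * X\<bar> \<le> \<bar>p * X - (1 - r) * Y\<bar> + \<bar>(1 - r) * Y\<bar>" by linarith
      moreover have "\<bar>p * X\<bar> = \<bar>X\<bar>" using p_unit by auto
      moreover have "\<bar>(1 - r) * Y\<bar> = (1 - r) * \<bar>Y\<bar>" using r by (simp add: abs_mult)
      moreover have "(1 - r) * \<bar>Y\<bar> < r * \<bar>Y\<bar>" using r Y by (intro mult_strict_right_mono) auto
      ultimately show False using le by argo
    qed
    then show ?thesis
      using E(3) small_bound[OF w16, of 1] sqrt_q(1)
      by (intro not_optimal_two_shifts[OF D w16 E(1,2), of 1])
        (simp_all only: P Q X_def flip: T_def, auto)
  next
    case 3
    have dvd3: "3 dvd w - 1" using 3 by (simp add: even_lucas_U_iff[OF q])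
    then obtain k where k: "w = Suc (3 * k)" using w0 by (auto elim!: dvdE) (metis Suc_pred)
    define Z where "Z = Re (\<tau> * cnj T)"
    \<comment> \<open>Prepares \<open>trace_power_3_large\<close> with \<open>M = 64 * q\<close>.
      Here \<open>w \<ge> 100\<close> gives \<open>k \<ge> 33\<close>, whereas 14 would suffice for
      this bound.\<close>
    have "(64 * real q ^ 1)\<^sup>2 \<le> real q ^ k" by (rule power_q_ge) (use k w in simp)
    then have "64 * real q \<le> 2 * \<bar>Re (\<tau> ^ (3 * k))\<bar>"
      using k w q_ge_2 by (intro trace_power_3_large) auto
    moreover have Z_eq: "Z = q * Re (\<tau> ^ (3 * k))"
    proof -
      have "\<tau> * cnj T = (\<tau> * cnj \<tau>) * cnj (\<tau> ^ (3 * k))" by (simp add: T_def k)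
      then show ?thesis unfolding Z_def tau_cnj by (simp del: complex_cnj_power)
    qed
    ultimately have "real q * (64 * real q) \<le> real q * (2 * \<bar>Re (\<tau> ^ (3 * k))\<bar>)"
      by (intro mult_left_mono) auto
    also have "\<dots> = 2 * \<bar>Z\<bar>" unfolding Z_eq by (simp add: abs_mult)
    finally have Z: "32 * (real q * real q) \<le> \<bar>Z\<bar>" by simp
    moreover have "0 < real q * real q" using q_ge_2 by simp
    ultimately have Z0: "Z \<noteq> 0" by linarith
    obtain a :: int where a: "odd a" "\<bar>2 * Y + a * Z\<bar> \<le> \<bar>Z\<bar>" "\<bar>a\<bar> * \<bar>Z\<bar> \<le> \<bar>Z\<bar> + 2 * \<bar>Y\<bar>"
      using Z0 by (rule odd_nearest)
    \<comment> \<open>A bare odd multiple of \<open>\<tau>\<close> would make \<open>E\<close>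
      divisible by \<open>\<tau>\<close>. Adding \<open>2 * cnj \<tau>\<close> contributes
      \<open>p\<close> to the constant coordinate of \<open>E\<close>, and the choice of
      \<open>a\<close> keeps the projection within that of \<open>\<tau>\<close>.\<close>
    define m where "m = of_int (2 * p) + of_int (a - 2) * \<tau>"
    have m_eq: "m = 2 * cnj \<tau> + of_int a * \<tau>" by (simp add: m_def cnj_tau algebra_simps)
    have ev: "even (2 * p - int q * lucas_U (w - 1))" using 3 by simp
    then obtain E where E: "E \<in> Ztau \<tau>" "\<not> Ztau_dvd \<tau> \<tau> E" "2 * E = \<tau> ^ w + m"
      unfolding m_def using half_sum[of w "2 * p" "a - 2"] w0 3 odd_q_dvd_half[OF q ev] qp a(1) by auto
    show ?thesis
    proof (rule not_optimal_if_le_tau[OF D w16 E])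
      show "m \<in> Ztau \<tau>" unfolding m_def by (rule in_Ztau)
      show "m \<noteq> 0" unfolding m_def Ztau_eq_0_iff using p_unit by auto
      have "m * cnj T = 2 * (cnj \<tau> * cnj T) + of_int a * (\<tau> * cnj T)"
        unfolding m_eq by (simp add: algebra_simps)
      then have "Re (m * cnj T) = 2 * Y + a * Z" unfolding Y_def Z_def by simp
      with a(2) show "\<bar>Re (m * cnj (\<tau> ^ w))\<bar> \<le> \<bar>Re (\<tau> * cnj (\<tau> ^ w))\<bar>"
        unfolding Z_def T_def by simp
      have Y_le: "\<bar>Y\<bar> \<le> sqrt q * cmod T"
        using abs_Re_le_cmod[of "cnj \<tau> * cnj T"] unfolding Y_def norm_mult complex_mod_cnj cmod_tau .
      define a' where "a' = real_of_int \<bar>a\<bar>"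
      have "a \<noteq> 0" using a(1) by auto
      then have "1 \<le> a'" unfolding a'_def by linarith
      \<comment> \<open>The lower bound on \<open>Z\<close> limits \<open>a\<close>: since
        \<open>(a' - 1) * \<bar>Z\<bar>\<close> is at most \<open>2 * \<bar>Y\<bar>\<close>, the
        length of \<open>m\<close> stays below the \<open>cmod T / (8 * sqrt q)\<close>
        required.\<close>
      then have "(a' - 1) * (32 * (real q * real q)) \<le> (a' - 1) * \<bar>Z\<bar>"
        using Z by (intro mult_left_mono) auto
      also have "\<dots> \<le> 2 * (sqrt q * cmod T)" using a(3) Y_le unfolding a'_def by (simp add: algebra_simps)
      finally have fin: "(a' - 1) * (32 * (real q * real q)) \<le> 2 * (sqrt q * cmod T)" .
      define s where "s = sqrt q"
      have "real q * real q = s * (s * (s * s))" by (simp add: s_def flip: mult.assoc)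
      moreover have "s * (c * (16 * (s * (s * s)))) \<le> s * t"
        if "c * (32 * (s * (s * (s * s)))) \<le> 2 * (s * t)" for c t
        using that by (simp add: algebra_simps)
      ultimately have "s * ((a' - 1) * (16 * (s * (s * s)))) \<le> s * cmod T"
        using fin by (simp only: s_def[symmetric])
      moreover have s1: "1 \<le> s" using sqrt_q(1) by (simp add: s_def)
      ultimately have a_le: "(a' - 1) * (16 * (s * (s * s))) \<le> cmod T" by simp
      then have "(a' - 1) * s \<le> cmod T / (16 * s * s)"
        using s1 by (simp add: le_divide_eq mult_ac)
      also have "\<dots> \<le> cmod T / (16 * s)"
        using s1 by (intro divide_left_mono) auto
      finally have "a' * s \<le> s + cmod T / s / 16" by (simp add: algebra_simps)
      moreover have "cmod m \<le> 2 * s + a' * s"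
      proof -
        have "cmod m \<le> cmod (2 * cnj \<tau>) + cmod (of_int a * \<tau>)"
          unfolding m_eq by (rule norm_triangle_ineq)
        then show ?thesis by (simp add: norm_mult cmod_tau s_def a'_def)
      qed
      moreover have "64 * s \<le> cmod T / s" using sqrt_q_large(1)[OF w16] by (simp add: T_def s_def)
      ultimately have "cmod m \<le> cmod T / s / 8" using s1 by argo
      then show "cmod m \<le> cmod (\<tau> ^ w) / (8 * sqrt q)" by (simp add: T_def s_def mult.commute)
    qed
  qed
qed

lemma not_optimal_100:
  assumes "min_norm_digit_set \<tau> w D" "100 \<le> w"
  shows "\<not> wNAF_optimal \<tau> w D"
  using assms not_optimal_even[of w D] not_optimal_odd[of w D] by (cases "even q") auto

end

section \<open>Computable and explicit thresholds\<close>

lemma nonoptimality_bound_ge_100: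
  assumes "2 \<le> q" "100 \<le> B"
  shows "nonoptimality_bound q B"
  unfolding nonoptimality_bound_def
proof (intro ballI allI impI)
  fix p \<tau> w D
  assume p: "p \<in> {-1, 1 :: int}" and \<tau>: "\<tau>\<^sup>2 - of_int p * \<tau> + of_nat q = 0"
    and w: "B \<le> real w" and D: "min_norm_digit_set \<tau> w D"
  interpret trace_one_base q p \<tau> by unfold_locales (use assms p \<tau> in auto)
  show "\<not> wNAF_optimal \<tau> w D" using D by (rule not_optimal_100) (use w assms in linarith)
qed

lemma effectively_computable_const: "effectively_computable (\<lambda>_. c)"
proof -
  have "total_recursive 1 (\<lambda>xs. c)"
  proof (induction c)
    case 0
    show ?case by (rule total_recursive.zero)
  next
    case (Suc c)
    have "total_recursive (length [\<lambda>xs::nat list. c]) (\<lambda>xs. Suc (hd xs))"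
      by (simp add: total_recursive.succ[simplified])
    from total_recursive.comp[OF this, of 1] Suc show ?case by simp
  qed
  then show ?thesis unfolding effectively_computable_def by (intro exI[of _ "\<lambda>xs. c"]) simp
qed

theorem theorem2p3:
  shows "(\<exists>w\<^sub>q :: nat \<Rightarrow> nat. effectively_computable w\<^sub>q \<and>
             (\<forall>q\<ge>2. nonoptimality_bound q (real (w\<^sub>q q)))) \<and>
         (\<forall>q\<ge>13. nonoptimality_bound q (8.68 * 10 ^ 15 * ln (real q) * ln (ln (real q)))) \<and>
         (\<forall>q\<in>{2..12}. nonoptimality_bound q (1.973 * 10 ^ 16))"
proof (intro conjI allI impI ballI)
  show "\<exists>w\<^sub>q :: nat \<Rightarrow> nat. effectively_computable w\<^sub>q \<and>
      (\<forall>q\<ge>2. nonoptimality_bound q (real (w\<^sub>q q)))"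
    \<comment> \<open>One threshold serves all \<open>q\<close>, so a constant function is
      enough.\<close>
    by (rule exI[of _ "\<lambda>_. 100"]) (simp add: effectively_computable_const nonoptimality_bound_ge_100)
  fix q :: nat assume q: "13 \<le> q"
  \<comment> \<open>From \<open>exp 2 \<le> 9\<close> follow \<open>ln q \<ge> 2\<close> and
    \<open>ln (ln q) \<ge> 1 / 2\<close>, so the product of the logarithms is at least 1 and the
    stated bound far exceeds 100.\<close>
  have "exp 2 = exp (1 :: real) * exp 1" by (simp flip: exp_add)
  also have "\<dots> \<le> 3 * 3" by (intro mult_mono exp_le) auto
  finally have "exp 2 \<le> real q" using q by simp
  then have ln: "2 \<le> ln (real q)" using q by (subst ln_ge_iff) auto
  have "1 / 2 \<le> ln (2 :: real)"
    using ln_le_minus_one[of "1 / 2 :: real"] by (simp add: ln_div)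
  also have "\<dots> \<le> ln (ln (real q))" using ln by (subst ln_le_cancel_iff) auto
  finally have "(8.68 * 10 ^ 15 * 2) * (1 / 2) \<le> (8.68 * 10 ^ 15 * ln (real q)) * ln (ln (real q))"
    using ln by (intro mult_mono) auto
  then show "nonoptimality_bound q (8.68 * 10 ^ 15 * ln (real q) * ln (ln (real q)))"
    using q by (intro nonoptimality_bound_ge_100) auto
qed (auto intro: nonoptimality_bound_ge_100)

end
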